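(* Let $X=\{X_t\}_{t\ge 0}$ be a critical CB process with branching mechanism $\psi$ satisfying $\psi'(0+)=0$ and $\int_{\theta_0}^{+\infty}\frac{d\xi}{\psi(\xi)}<+\infty$ for some $\theta_0>0$. Suppose that $\psi(\lambda)=\lambda^{1+\alpha}L(1/\lambda)$ for all $\lambda>0$, where $0<\alpha\le 1$ and $L$ is slowly varying at $+\infty$. Then there is a probability distribution function $H_\alpha$ on $[0,+\infty)$ such that for all $x>0$ and $y\ge 0$, $$\lim_{t\to+\infty}P_x\left(\bar F(t)X_t\le y\,\middle|\,\tau>t\right)=H_\alpha(y),$$ and the Laplace transform of $H_\alpha$ is given, for $\theta>0$, by $$h_\alpha(\theta)=\int_{[0,+\infty)}e^{-\theta y}\,dH_\alpha(y)=1-(1+\theta^{-\alpha})^{-1/\alpha}.$$ Moreover, $\bar F(t)$ is regularly varying at $+\infty$ with index $-1/\alpha$, and consequently, for any $\delta>0$, $$\lim_{t\to+\infty}t^{\frac1\alpha+\delta}\bar F(t)=+\infty,\qquad \lim_{t\to+\infty}t^{\frac1\alpha-\delta}\bar F(t)=0.$$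
   Context: A (conservative) continuous-state branching process (CB process) is a $[0,+\infty)$-valued strong Markov process $X=\{X_t:t\ge 0\}$ with probabilities $\{P_x:x>0\}$ ($X$ starts at $x$ under $P_x$), with right-continuous paths having left limits, satisfying the branching property $E_{x+y}(e^{-\lambda X_t})=E_x(e^{-\lambda X_t})E_y(e^{-\lambda X_t})$ for all $\lambda,t\ge 0$, $x,y>0$. It is characterized by its branching mechanism $$\psi(\lambda)=a\lambda+b\lambda^2+\int_{(0,+\infty)}(e^{-\lambda x}-1+\lambda x)\,\Lambda(dx),\quad \lambda\ge 0,$$ with $a\in\mathbb R$, $b\ge 0$, and $\Lambda$ (the L\'evy measure of $\psi$) a non-negative measure on $(0,+\infty)$ with $\int_{(0,+\infty)}(x^2\wedge x)\Lambda(dx)<+\infty$, in the sense that $E_x(e^{-\lambda X_t})=e^{-x u_t(\lambda)}$, where $u_t(\lambda)$ is the unique positive solution of $\frac{\partial}{\partial t}u_t(\lambda)=-\psi(u_t(\lambda))$, $u_0(\lambda)=\lambda$. The process is called critical if $\psi'(0+)=0$. $\tau:=\inf\{t\ge 0:X_t=0\}$ is the extinction time (so $\{\tau>t\}=\{X_t>0\}$ almost surely), and $\bar F(t):=P_1(\tau>t)$. A positive measurable function $L$ on $(0,+\infty)$ is slowly varying at $+\infty$ if $\lim_{x\to+\infty}L(\lambda x)/L(x)=1$ for all $\lambda>0$. A positive function $f$ on $(0,+\infty)$ is regularly varying at $+\infty$ with index $p\in\mathbb R$ if $\lim_{x\to+\infty}f(\lambda x)/f(x)=\lambda^p$ for all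 $\lambda>0$. *)

theory Defs
  imports "HOL-Probability.Probability" "HOL-Probability.Stopping_Time"
begin

section \<open>Regular variation at infinity\<close>

definition slowly_varying :: "(real \<Rightarrow> real) \<Rightarrow> bool" where
  "slowly_varying L \<longleftrightarrow>
     L \<in> borel_measurable (restrict_space borel {0<..}) \<and> (\<forall>x>0. 0 < L x) \<and>
     (\<forall>z>0. ((\<lambda>x. L (z * x) / L x) \<longlongrightarrow> 1) at_top)"

definition regularly_varying :: "(real \<Rightarrow> real) \<Rightarrow> real \<Rightarrow> bool" where
  "regularly_varying f p \<longleftrightarrow>
     (\<forall>x>0. 0 < f x) \<and> (\<forall>z>0. ((\<lambda>x. f (z * x) / f x) \<longlongrightarrow> z powr p) at_top)"


section \<open>Branching mechanisms\<close>

text \<open>A Levy measure is a measure whose underlying space is the open half-line.\<close>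

definition levy_measure :: "real measure \<Rightarrow> bool" where
  "levy_measure \<Lambda> \<longleftrightarrow>
     sets \<Lambda> = sets (restrict_space borel {0<..}) \<and> integrable \<Lambda> (\<lambda>x. min (x\<^sup>2) x)"

text \<open>Only the values of the branching mechanism on the closed half-line are constrained.\<close>

definition branching_mechanism :: "(real \<Rightarrow> real) \<Rightarrow> bool" where
  "branching_mechanism \<psi> \<longleftrightarrow>
     (\<exists>a b \<Lambda>. 0 \<le> b \<and> levy_measure \<Lambda> \<and>
        (\<forall>z\<ge>0. \<psi> z = a * z + b * z\<^sup>2 + (\<integral>x. (exp (- z * x) - 1 + z * x) \<partial>\<Lambda>)))"

text \<open>\<open>\<psi>'(0+) = 0\<close>, read as a limit of derivatives from the right.\<close>

definition critical :: "(real \<Rightarrow> real) \<Rightarrow> bool" where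
  "critical \<psi> \<longleftrightarrow> (deriv \<psi> \<longlongrightarrow> 0) (at_right 0)"

text \<open>\<open>u t z\<close> stands for \<open>u\<^sub>t(z)\<close>. A branching mechanism is continuously differentiable on the
  closed half-line, so the positive solution of the differential equation is unique. For
  \<open>z = 0\<close> the corresponding function is identically zero and carries no information.\<close>

definition cumulant_flow :: "(real \<Rightarrow> real) \<Rightarrow> (real \<Rightarrow> real \<Rightarrow> real) \<Rightarrow> bool" where
  "cumulant_flow \<psi> u \<longleftrightarrow>
     (\<forall>z>0. u 0 z = z \<and>
        (\<forall>t\<ge>0. 0 < u t z \<and>
           ((\<lambda>s. u s z) has_real_derivative - \<psi> (u t z)) (at t within {0..})))"


section \<open>Continuous-state branching processes\<close>

text \<open>The time index includes \<open>\<infinity>\<close>, so that stopping times may take the value \<open>\<infinity>\<close>.\<close>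

definition natural_filtration ::
    "'w set \<Rightarrow> (real \<Rightarrow> 'w \<Rightarrow> real) \<Rightarrow> ennreal \<Rightarrow> 'w measure" where
  "natural_filtration \<Omega> X t =
     sigma \<Omega> {X s -` B \<inter> \<Omega> | s B. 0 \<le> s \<and> ennreal s \<le> t \<and> B \<in> sets borel}"

lemma filtration_natural_filtration: "filtration \<Omega> (natural_filtration \<Omega> X)"
proof
  show "space (natural_filtration \<Omega> X t) = \<Omega>" for t
    unfolding natural_filtration_def by (rule space_measure_of) auto
  show "sets (natural_filtration \<Omega> X s) \<le> sets (natural_filtration \<Omega> X t)" if "s \<le> t" for s t
  proof -
    let ?G = "\<lambda>t. {X r -` B \<inter> \<Omega> | r B. 0 \<le> r \<and> ennreal r \<le> t \<and> B \<in> sets borel}"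
    have "?G s \<subseteq> ?G t"
      using order_trans[OF _ that] by blast
    moreover have "?G s \<subseteq> Pow \<Omega>" "?G t \<subseteq> Pow \<Omega>"
      by auto
    ultimately show ?thesis
      unfolding natural_filtration_def by (simp add: sets_measure_of sigma_sets_mono')
  qed
qed

text \<open>The law is only given for starting points \<open>x > 0\<close>; the state \<open>0\<close> is a trap.\<close>

definition transition ::
    "(real \<Rightarrow> 'w measure) \<Rightarrow> (real \<Rightarrow> 'w \<Rightarrow> real) \<Rightarrow> real \<Rightarrow> (real \<Rightarrow> real) \<Rightarrow> real \<Rightarrow> real" where
  "transition P X s f y = (if y = 0 then f 0 else (\<integral>\<omega>. f (X s \<omega>) \<partial>P y))"

locale cb_process =
  fixes P :: "real \<Rightarrow> 'w measure" and X :: "real \<Rightarrow> 'w \<Rightarrow> real"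
  assumes prob_space_P: "0 < x \<Longrightarrow> prob_space (P x)"
    and sets_P: "0 < x \<Longrightarrow> sets (P x) = sets (P 1)"
    and measurable_X: "0 < x \<Longrightarrow> 0 \<le> t \<Longrightarrow> X t \<in> borel_measurable (P x)"
    and X_nonneg: "0 \<le> t \<Longrightarrow> \<omega> \<in> space (P 1) \<Longrightarrow> 0 \<le> X t \<omega>"
    and right_continuous:
      "0 \<le> t \<Longrightarrow> \<omega> \<in> space (P 1) \<Longrightarrow> continuous (at_right t) (\<lambda>s. X s \<omega>)"
    and left_limits:
      "0 < t \<Longrightarrow> \<omega> \<in> space (P 1) \<Longrightarrow> \<exists>l. ((\<lambda>s. X s \<omega>) \<longlongrightarrow> l) (at_left t)"
    and starting_point: "0 < x \<Longrightarrow> AE \<omega> in P x. X 0 \<omega> = x"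
    and measurable_law:
      "0 \<le> t \<Longrightarrow> B \<in> sets borel \<Longrightarrow>
         (\<lambda>x. \<P>(\<omega> in P x. X t \<omega> \<in> B)) \<in> borel_measurable (restrict_space borel {0<..})"
    and strong_markov:
      "0 < x \<Longrightarrow> stopping_time (natural_filtration (space (P x)) X) T \<Longrightarrow> 0 \<le> s \<Longrightarrow>
       f \<in> borel_measurable borel \<Longrightarrow> bounded (range f) \<Longrightarrow>
         AE \<omega> in P x. T \<omega> < \<infinity> \<longrightarrow>
           real_cond_exp (P x)
             (filtration.pre_sigma (space (P x)) (natural_filtration (space (P x)) X) T)
             (\<lambda>\<omega>'. if T \<omega>' < \<infinity> then f (X (enn2real (T \<omega>') + s) \<omega>') else 0) \<omega>
           = transition P X s f (X (enn2real (T \<omega>)) \<omega>)"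
    and branching:
      "0 < x \<Longrightarrow> 0 < y \<Longrightarrow> 0 \<le> z \<Longrightarrow> 0 \<le> t \<Longrightarrow>
         (\<integral>\<omega>. exp (- z * X t \<omega>) \<partial>P (x + y)) =
         (\<integral>\<omega>. exp (- z * X t \<omega>) \<partial>P x) * (\<integral>\<omega>. exp (- z * X t \<omega>) \<partial>P y)"

definition has_branching_mechanism ::
    "(real \<Rightarrow> 'w measure) \<Rightarrow> (real \<Rightarrow> 'w \<Rightarrow> real) \<Rightarrow> (real \<Rightarrow> real) \<Rightarrow> bool" where
  "has_branching_mechanism P X \<psi> \<longleftrightarrow>
     branching_mechanism \<psi> \<and>
     (\<exists>u. cumulant_flow \<psi> u \<and>
        (\<forall>x>0. \<forall>t\<ge>0. \<forall>z>0. (\<integral>\<omega>. exp (- z * X t \<omega>) \<partial>P x) = exp (- x * u t z)))"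

definition extinction_time :: "(real \<Rightarrow> 'w \<Rightarrow> real) \<Rightarrow> 'w \<Rightarrow> ennreal" where
  "extinction_time X \<omega> = Inf {ennreal t | t. 0 \<le> t \<and> X t \<omega> = 0}"

text \<open>Events involving the extinction time, being a hitting time, are in general only measurable
  with respect to the completion of the underlying measure.\<close>

definition survival :: "(real \<Rightarrow> 'w measure) \<Rightarrow> (real \<Rightarrow> 'w \<Rightarrow> real) \<Rightarrow> real \<Rightarrow> real" where
  "survival P X t = \<P>(\<omega> in completion (P 1). ennreal t < extinction_time X \<omega>)"

end

theory Submission
  imports Defs
begin

text \<open>With \<open>G z = \<integral>\<^bsub>z\<^esub>\<^bsup>\<infinity>\<^esup> d\<xi> / \<psi> \<xi>\<close> the flow satisfies \<open>G (u t z) = t + G z\<close>; letting \<open>z\<close> tend to infinity,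
  \<open>P\<^sub>x(\<tau> > t) = 1 - exp (- x * \<phi> t)\<close> where \<open>\<phi>\<close> inverts \<open>G\<close>. Since \<open>G\<close> is regularly varying at \<open>0\<close> with
  index \<open>- \<alpha>\<close>, the functions \<open>\<phi>\<close> and \<open>survival P X\<close> are regularly varying with index \<open>- 1 / \<alpha>\<close>, and
  \<open>G (u t (\<theta> * survival P X t)) / G (\<phi> t)\<close> tends to \<open>1 + \<theta> powr (- \<alpha>)\<close>. Inverting \<open>G\<close> gives the limit of
  the conditional Laplace transforms. The limit law has no atoms, so its distribution function is the
  limit at every point.\<close>

section \<open>Laplace transforms of laws on the half-line\<close>

text \<open>Two obstacles shape the proof. First, extinction is a hitting time, and a path that has
  touched 0 is not assumed to stay there. The Markov property at deterministic times gives a maximal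
  inequality over finite sets of times. Letting these sets exhaust the rationals and the level tend
  to 0 shows that \<open>X t\<close> vanishes almost surely on the paths that came arbitrarily near
  0 by time \<open>t\<close>. Survival thus agrees with \<open>0 < X t \<omega>\<close> up to a null
  set, and its probability can be read off the transform of \<open>X t\<close>. Second, weak
  convergence controls distribution functions only at continuity points, while the limit is known
  through its transform alone. Atoms are excluded by a fixed point equation for the law, in which
  \<alpha> \<le> 1 turns binomial coefficients into probabilities. Convergence of transforms becomes
  weak convergence through tightness together with uniqueness, and uniqueness is reduced to Levy's
  theorem by passing to the bounded variable \<open>exp (- Y)\<close>.\<close>

definition laplace_law :: "real measure \<Rightarrow> (real \<Rightarrow> real) \<Rightarrow> bool" where
  "laplace_law \<mu> g \<longleftrightarrow>
     real_distribution \<mu> \<and> (AE y in \<mu>. 0 \<le> y) \<and> (\<forall>\<theta>>0. (\<integral>y. exp (- \<theta> * y) \<partial>\<mu>) = g \<theta>)"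

lemma laplace_law_integrable:
  assumes "laplace_law \<mu> g" "0 \<le> \<theta>"
  shows "integrable \<mu> (\<lambda>y. exp (- \<theta> * y))"
proof -
  interpret real_distribution \<mu> using assms by (simp add: laplace_law_def)
  have "AE y in \<mu>. 0 \<le> y" using assms by (simp add: laplace_law_def)
  then have "AE y in \<mu>. norm (exp (- \<theta> * y)) \<le> 1"
    by eventually_elim (use assms in auto)
  then show ?thesis by (rule integrable_const_bound) simp
qed

lemma laplace_law_cong:
  assumes "laplace_law \<mu> g" "\<And>\<theta>. 0 < \<theta> \<Longrightarrow> g \<theta> = g' \<theta>"
  shows "laplace_law \<mu> g'"
  using assms by (simp add: laplace_law_def)

lemma laplace_law_bounds:
  assumes "laplace_law \<mu> g" "0 < \<theta>"
  shows "0 < g \<theta>" "g \<theta> \<le> 1"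
proof -
  interpret real_distribution \<mu> using assms by (simp add: laplace_law_def)
  have AE: "AE y in \<mu>. 0 \<le> y" and g: "g \<theta> = (\<integral>y. exp (- \<theta> * y) \<partial>\<mu>)"
    using assms by (simp_all add: laplace_law_def)
  have int: "integrable \<mu> (\<lambda>y. exp (- \<theta> * y))"
    using assms by (intro laplace_law_integrable) auto
  have "(\<integral>y. exp (- \<theta> * y) \<partial>\<mu>) \<noteq> 0"
    using integral_nonneg_eq_0_iff_AE[OF int] by simp
  moreover have "0 \<le> (\<integral>y. exp (- \<theta> * y) \<partial>\<mu>)" by simp
  ultimately show "0 < g \<theta>" unfolding g by linarith
  have "(\<integral>y. exp (- \<theta> * y) \<partial>\<mu>) \<le> (\<integral>y. 1 \<partial>\<mu>)"
  proof (rule integral_mono_AE[OF int])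
    show "AE y in \<mu>. exp (- \<theta> * y) \<le> 1"
      using AE by eventually_elim (use assms in auto)
  qed simp
  then show "g \<theta> \<le> 1" by (simp add: g prob_space[simplified])
qed

text \<open>The law of \<open>exp (- Y)\<close> lives on the unit interval and the Laplace transform gives its moments,
  so its characteristic function is determined.\<close>

lemma laplace_law_char:
  assumes "laplace_law \<mu> g"
  shows "(\<lambda>n. \<Sum>k\<le>n. ((\<i> * t)^k / fact k) * complex_of_real (if k = 0 then 1 else g (real k)))
           \<longlonglongrightarrow> char (distr \<mu> borel (\<lambda>y. exp (- y))) t"
proof -
  interpret real_distribution \<mu> using assms by (simp add: laplace_law_def)
  have int: "integrable \<mu> (\<lambda>y. (exp (- y)) ^ k)" for k
    using laplace_law_integrable[OF assms, of "real k"] by (simp add: exp_of_nat_mult[symmetric])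
  \<comment> \<open>\<open>laplace_law\<close> leaves \<open>g\<close> free at 0, so the moment of
    order 0 is entered by hand.\<close>
  have ev: "expectation (\<lambda>y. (exp (- y)) ^ k) = (if k = 0 then 1 else g (real k))" for k
    using assms by (auto simp: laplace_law_def prob_space[simplified] exp_of_nat_mult[symmetric])
  \<comment> \<open>The moments of a variable in the unit interval are at most 1, so the Taylor
    remainder of the characteristic function is dominated by the terms of an exponential
    series.\<close>
  have bd: "cmod (char (distr \<mu> borel (\<lambda>y. exp (- y))) t
      - (\<Sum>k\<le>n. ((\<i> * t)^k / fact k) * complex_of_real (if k = 0 then 1 else g (real k)))) \<le> 2 * \<bar>t\<bar>^n / fact n" for n
  proof -
    have "cmod (char (distr \<mu> borel (\<lambda>y. exp (- y))) t
      - (\<Sum>k\<le>n. ((\<i> * t)^k / fact k) * expectation (\<lambda>y. (exp (- y))^k)))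
      \<le> (2 * \<bar>t\<bar>^n / fact n) * expectation (\<lambda>y. \<bar>exp (- y)\<bar>^n)"
      by (rule char_approx1') (use int in auto)
    also have "\<dots> \<le> (2 * \<bar>t\<bar>^n / fact n) * 1"
      using laplace_law_bounds(2)[OF assms, of "real n"] by (intro mult_left_mono) (auto simp: ev)
    finally show ?thesis unfolding ev by simp
  qed
  have "(\<lambda>n. 2 * \<bar>t\<bar>^n / fact n) \<longlonglongrightarrow> 0"
    using tendsto_mult[OF tendsto_const[of 2] summable_LIMSEQ_zero[OF summable_exp[of "\<bar>t\<bar>"]]]
    by (simp add: field_simps)
  then have "(\<lambda>n. char (distr \<mu> borel (\<lambda>y. exp (- y))) t
      - (\<Sum>k\<le>n. ((\<i> * t)^k / fact k) * complex_of_real (if k = 0 then 1 else g (real k)))) \<longlonglongrightarrow> 0"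
    by (rule Lim_null_comparison[rotated]) (use bd in auto)
  from tendsto_diff[OF tendsto_const[of "char (distr \<mu> borel (\<lambda>y. exp (- y))) t"] this] show ?thesis
    by simp
qed

text \<open>The transform at the positive integers lists the moments of \<open>exp (- Y)\<close>,
  which fix its characteristic function and so its law. The map \<open>- ln x\<close> then undoes
  the exponential.\<close>

lemma laplace_law_unique:
  assumes "laplace_law \<mu> g" "laplace_law \<nu> g"
  shows "\<mu> = \<nu>"
proof -
  interpret m: real_distribution \<mu> using assms by (simp add: laplace_law_def)
  interpret n: real_distribution \<nu> using assms by (simp add: laplace_law_def)
  have eq: "distr \<mu> borel (\<lambda>y. exp (- y)) = distr \<nu> borel (\<lambda>y. exp (- y))"
  proof (rule Levy_uniqueness)
    show "char (distr \<mu> borel (\<lambda>y. exp (- y))) = char (distr \<nu> borel (\<lambda>y. exp (- y)))"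
      by (rule ext) (rule LIMSEQ_unique[OF laplace_law_char[OF assms(1)] laplace_law_char[OF assms(2)]])
  qed (simp_all add: m.real_distribution_distr n.real_distribution_distr)
  have "distr (distr M borel (\<lambda>y. exp (- y))) borel (\<lambda>x. - ln x) = M"
    if M: "sets M = sets borel" for M :: "real measure"
  proof -
    have "(\<lambda>y::real. exp (- y)) \<in> M \<rightarrow>\<^sub>M borel"
      unfolding measurable_cong_sets[OF M refl] by measurable
    then have "distr (distr M borel (\<lambda>y. exp (- y))) borel (\<lambda>x. - ln x) = distr M borel (\<lambda>y. y)"
      by (subst distr_distr) (auto simp: o_def)
    then show ?thesis by (simp add: distr_id2 M)
  qed
  note inv = this
  have "\<mu> = distr (distr \<mu> borel (\<lambda>y. exp (- y))) borel (\<lambda>x. - ln x)"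
    by (rule inv[symmetric]) simp
  also have "\<dots> = distr (distr \<nu> borel (\<lambda>y. exp (- y))) borel (\<lambda>x. - ln x)"
    by (simp only: eq)
  also have "\<dots> = \<nu>" by (rule inv) simp
  finally show ?thesis .
qed

section \<open>Tightness and the continuity theorem for Laplace transforms\<close>

lemma laplace_law_tail:
  assumes "laplace_law \<mu> g" "0 < R"
  shows "measure \<mu> {R<..} \<le> 2 * (1 - g (1 / R))"
proof -
  interpret real_distribution \<mu> using assms by (simp add: laplace_law_def)
  have AE: "AE y in \<mu>. 0 \<le> y" and lt: "\<forall>\<theta>>0. (\<integral>y. exp (- \<theta> * y) \<partial>\<mu>) = g \<theta>"
    using assms unfolding laplace_law_def by auto
  have g: "g (1 / R) = (\<integral>y. exp (- (1 / R) * y) \<partial>\<mu>)"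
    using lt[rule_format, of "1 / R"] assms(2) by simp
  have int: "integrable \<mu> (\<lambda>y. exp (- (1 / R) * y))"
    using assms by (intro laplace_law_integrable) auto
  have "measure \<mu> {R<..} = (\<integral>y. indicator {R<..} y \<partial>\<mu>)" by simp
  also have "\<dots> \<le> (\<integral>y. 2 * (1 - exp (- (1 / R) * y)) \<partial>\<mu>)"
  proof (rule integral_mono_AE)
    show "AE y in \<mu>. indicator {R<..} y \<le> 2 * (1 - exp (- (1 / R) * y))"
      using AE
    proof eventually_elim
      case (elim y)
      show ?case
      proof (cases "R < y")
        \<comment> \<open>Markov's inequality for \<open>1 - exp (- y / R)\<close>: beyond
          \<open>R\<close> this is at least 1 - 1/e, hence at least 1/2, which explains the factor
          2.\<close>
        case True
        have "exp (- (1 / R) * y) \<le> exp (- 1)" using True assms by (simp add: field_simps)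
        moreover have "exp (- 1) \<le> (1 / 2 :: real)"
          using exp_ge_add_one_self[of "1::real"] by (simp add: exp_minus field_simps)
        ultimately have "exp (- (1 / R) * y) \<le> 1 / 2" by linarith
        then show ?thesis using True by (simp del: mult_minus_left)
      qed (use elim assms in auto)
    qed
    show "integrable \<mu> (\<lambda>y. indicator {R<..} y :: real)"
      by (rule integrable_const_bound[where B=1]) auto
  qed (use int in auto)
  also have "\<dots> = 2 * (1 - g (1 / R))" using int by (simp add: g prob_space[simplified])
  finally show ?thesis .
qed

text \<open>Convergence of \<open>h\<close> to 1 at 0 bounds the tails of all but finitely many laws
  at once; each of the remaining laws is tight by itself.\<close>

lemma tight_laplace_law:
  assumes M: "\<And>n. laplace_law (M n) (g n)"
    and lim: "\<And>\<theta>. 0 < \<theta> \<Longrightarrow> (\<lambda>n. g n \<theta>) \<longlonglongrightarrow> h \<theta>" and h: "(h \<longlongrightarrow> 1) (at_right 0)"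
  shows "tight M"
  unfolding tight_def
proof (intro conjI allI impI)
  show rd: "real_distribution (M n)" for n using M by (simp add: laplace_law_def)
  fix \<epsilon> :: real assume \<epsilon>: "0 < \<epsilon>"
  \<comment> \<open>The tail bound doubles the defect, so a defect below \<epsilon>/4 costs at most
    \<epsilon>/2.\<close>
  have "eventually (\<lambda>\<theta>. 1 - \<epsilon> / 4 < h \<theta> \<and> 0 < \<theta>) (at_right 0)"
    using order_tendstoD(1)[OF h, of "1 - \<epsilon> / 4"] \<epsilon> by (simp add: eventually_conj_iff eventually_at_right_less)
  from eventually_happens'[OF _ this] obtain \<theta> where \<theta>: "0 < \<theta>" "1 - \<epsilon> / 4 < h \<theta>" by auto
  have "eventually (\<lambda>n. 1 - \<epsilon> / 4 < g n \<theta>) sequentially"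
    using order_tendstoD(1)[OF lim[OF \<theta>(1)] \<theta>(2)] .
  then obtain N where N: "\<And>n. n \<ge> N \<Longrightarrow> 1 - \<epsilon> / 4 < g n \<theta>" by (auto simp: eventually_sequentially)
  have ex: "\<exists>b. measure (M n) {b<..} < \<epsilon> \<and> 0 < b" for n
  proof -
    interpret real_distribution "M n" by (rule rd)
    have "eventually (\<lambda>b. 1 - \<epsilon> < cdf (M n) b \<and> 0 < b) at_top"
      using order_tendstoD(1)[OF cdf_lim_at_top_prob, of "1 - \<epsilon>"] \<epsilon>
      by (simp add: eventually_conj_iff eventually_gt_at_top)
    from eventually_happens'[OF _ this] obtain b where b: "1 - \<epsilon> < cdf (M n) b" "0 < b" by auto
    have "measure (M n) {b<..} = 1 - cdf (M n) b"
      using prob_compl[of "{..b}"] by (simp add: cdf_def Compl_eq_Diff_UNIV[symmetric])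
    with b show ?thesis by (intro exI[of _ b]) linarith
  qed
  then obtain b where b: "\<And>n. measure (M n) {b n<..} < \<epsilon>" "\<And>n. 0 < b n" by metis
  define B where "B = Max (insert (1 / \<theta>) (b ` {..<N}))"
  have B: "0 < B"
    unfolding B_def using \<theta> by (subst Max_gr_iff) auto
  \<comment> \<open>The left end is -1 because the interval is open there and the laws may charge
    0.\<close>
  have "measure (M n) {-1<..B} > 1 - \<epsilon>" for n
  proof -
    interpret real_distribution "M n" by (rule rd)
    have AE: "AE y in M n. 0 \<le> y" using M by (simp add: laplace_law_def)
    have tail: "measure (M n) {B<..} < \<epsilon>"
    proof (cases "n < N")
      case True
      then have "b n \<le> B" unfolding B_def by (intro Max_ge) auto
      then have "measure (M n) {B<..} \<le> measure (M n) {b n<..}" by (intro finite_measure_mono) auto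
      with b(1)[of n] show ?thesis by simp
    next
      case False
      have "1 / \<theta> \<le> B" unfolding B_def by (intro Max_ge) auto
      then have "measure (M n) {B<..} \<le> measure (M n) {1 / \<theta><..}" by (intro finite_measure_mono) auto
      also have "\<dots> \<le> 2 * (1 - g n \<theta>)" using laplace_law_tail[OF M, of "1 / \<theta>" n] \<theta> by simp
      also have "\<dots> < \<epsilon>" using N[of n] False \<epsilon> by simp
      finally show ?thesis .
    qed
    have "prob {-1<..B} = prob (UNIV - {B<..})"
      by (rule finite_measure_eq_AE) (use AE in \<open>auto elim!: eventually_mono\<close>)
    also have "\<dots> = 1 - prob {B<..}" using prob_compl[of "{B<..}"] by simp
    finally show ?thesis using tail by simp
  qed
  with B show "\<exists>a b. a < b \<and> (\<forall>n. 1 - \<epsilon> < measure (M n) {a<..b})" by (intro exI[of _ "-1"] exI[of _ B]) auto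
qed

lemma weak_limit_laplace_law:
  assumes M: "\<And>n. laplace_law (M n) (g n)"
    and lim: "\<And>\<theta>. 0 < \<theta> \<Longrightarrow> (\<lambda>n. g n \<theta>) \<longlonglongrightarrow> h \<theta>"
    and \<mu>: "real_distribution \<mu>" and conv: "weak_conv_m M \<mu>"
  shows "laplace_law \<mu> h"
proof -
  interpret real_distribution \<mu> by (rule \<mu>)
  have rd: "real_distribution (M n)" for n using M by (simp add: laplace_law_def)
  have AE_n: "AE y in M n. 0 \<le> y" for n using M by (simp add: laplace_law_def)
  have bc: "(\<lambda>n. \<integral>y. f y \<partial>M n) \<longlonglongrightarrow> (\<integral>y. f y \<partial>\<mu>)"
    if "\<And>x. isCont f x" "\<And>x. \<bar>f x\<bar> \<le> 1" for f :: "real \<Rightarrow> real"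
    using that by (intro weak_conv_imp_integral_bdd_continuous_conv[OF rd \<mu> conv]) auto
  have AE: "AE y in \<mu>. 0 \<le> y"
  proof -
    \<comment> \<open>A bounded continuous test function whose zero set is the closed
      half-line.\<close>
    let ?f = "\<lambda>y::real. min 1 (max 0 (- y))"
    have "(\<integral>y. ?f y \<partial>M n) = 0" for n
      using AE_n[of n] by (subst integral_eq_zero_AE) (auto elim!: eventually_mono)
    moreover have "(\<lambda>n. \<integral>y. ?f y \<partial>M n) \<longlonglongrightarrow> (\<integral>y. ?f y \<partial>\<mu>)"
      by (rule bc) (auto intro!: continuous_intros)
    ultimately have "(\<integral>y. ?f y \<partial>\<mu>) = 0"
      by (simp add: LIMSEQ_const_iff)
    moreover have "integrable \<mu> ?f" by (rule integrable_const_bound[where B=1]) auto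
    ultimately have "AE y in \<mu>. ?f y = 0"
      by (subst (asm) integral_nonneg_eq_0_iff_AE) auto
    then show ?thesis
    proof eventually_elim
      case (elim y)
      then show ?case by (cases "y < 0") (auto simp: min_def max_def split: if_splits)
    qed
  qed
  have "(\<integral>y. exp (- \<theta> * y) \<partial>\<mu>) = h \<theta>" if \<theta>: "0 < \<theta>" for \<theta>
  proof -
    \<comment> \<open>\<open>exp (- \<theta> * y)\<close> is unbounded on the negative axis. Taking
      the absolute value of \<open>y\<close> gives a bounded continuous function with the same
      integral.\<close>
    have cong: "(\<integral>y. exp (- \<theta> * \<bar>y\<bar>) \<partial>K) = (\<integral>y. exp (- \<theta> * y) \<partial>K)"
      if "AE y in K. 0 \<le> y" "real_distribution K" for K
    proof -
      interpret K: real_distribution K by fact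
      have "AE y in K. exp (- \<theta> * \<bar>y\<bar>) = exp (- \<theta> * y)"
        using that(1) by eventually_elim simp
      then show ?thesis by (intro integral_cong_AE) auto
    qed
    have "(\<lambda>n. \<integral>y. exp (- \<theta> * \<bar>y\<bar>) \<partial>M n) \<longlonglongrightarrow> (\<integral>y. exp (- \<theta> * \<bar>y\<bar>) \<partial>\<mu>)"
      using \<theta> by (intro bc) (auto intro!: continuous_intros)
    also have "(\<lambda>n. \<integral>y. exp (- \<theta> * \<bar>y\<bar>) \<partial>M n) = (\<lambda>n. g n \<theta>)"
      unfolding cong[OF AE_n rd] using M \<theta> by (simp add: laplace_law_def)
    finally show ?thesis using LIMSEQ_unique[OF _ lim[OF \<theta>]] cong[OF AE \<mu>] by auto
  qed
  with AE \<mu> show ?thesis by (simp add: laplace_law_def)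
qed

text \<open>Tightness yields convergent subsequences, and each subsequential limit has the transform
  \<open>h\<close>. Uniqueness makes these limits equal, hence the whole sequence converges. The
  existence of a law with transform \<open>h\<close> comes out of the same argument.\<close>

theorem laplace_continuity:
  assumes M: "\<And>n. laplace_law (M n) (g n)"
    and lim: "\<And>\<theta>. 0 < \<theta> \<Longrightarrow> (\<lambda>n. g n \<theta>) \<longlonglongrightarrow> h \<theta>" and h: "(h \<longlongrightarrow> 1) (at_right 0)"
  obtains \<mu> where "laplace_law \<mu> h" "weak_conv_m M \<mu>"
proof -
  have tight: "tight M" by (rule tight_laplace_law[OF assms])
  have sub: "laplace_law \<nu> h" if "strict_mono s" "real_distribution \<nu>" "weak_conv_m (M \<circ> s) \<nu>" for s \<nu>
  proof (rule weak_limit_laplace_law[OF _ _ that(2,3)])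
    show "laplace_law ((M \<circ> s) n) (g (s n))" for n using M by simp
    show "(\<lambda>n. g (s n) \<theta>) \<longlonglongrightarrow> h \<theta>" if "0 < \<theta>" for \<theta>
      using LIMSEQ_subseq_LIMSEQ[OF lim[OF that] \<open>strict_mono s\<close>] by (simp add: o_def)
  qed
  obtain r \<mu> where "strict_mono (r :: nat \<Rightarrow> nat)" "real_distribution \<mu>" "weak_conv_m (M \<circ> id \<circ> r) \<mu>"
    using tight_imp_convergent_subsubsequence[OF tight strict_mono_id] by auto
  with sub have \<mu>: "laplace_law \<mu> h" by simp
  have "weak_conv_m M \<mu>"
  proof (rule tight_subseq_weak_converge[OF _ _ tight])
    fix s \<nu> assume *: "strict_mono s" "real_distribution \<nu>" "weak_conv_m (M \<circ> s) \<nu>"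
    have "\<nu> = \<mu>" using laplace_law_unique[OF sub[OF *] \<mu>] .
    with * show "weak_conv_m (M \<circ> s) \<mu>" by simp
  qed (use M \<mu> in \<open>simp_all add: laplace_law_def\<close>)
  with \<mu> show thesis by (rule that)
qed

section \<open>Sums, mixtures and random scalings of laws on the half-line\<close>

lemma laplace_law_return: "laplace_law (return borel 0) (\<lambda>_. 1)"
  by (auto simp: laplace_law_def real_distribution_def real_distribution_axioms_def prob_space_return
      AE_return integral_return)

lemma laplace_law_mult:
  assumes "laplace_law \<mu> g" "laplace_law \<nu> h"
  shows "\<exists>\<kappa>. laplace_law \<kappa> (\<lambda>\<theta>. g \<theta> * h \<theta>)"
proof
  interpret m: real_distribution \<mu> using assms by (simp add: laplace_law_def)
  interpret n: real_distribution \<nu> using assms by (simp add: laplace_law_def)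
  interpret pair_prob_space \<mu> \<nu> ..
  let ?M = "\<mu> \<Otimes>\<^sub>M \<nu>" and ?f = "\<lambda>p. fst p + snd p :: real"
  have AEs: "AE y in \<mu>. 0 \<le> y" "AE y in \<nu>. 0 \<le> y" using assms by (simp_all add: laplace_law_def)
  have AE: "AE p in ?M. 0 \<le> ?f p"
  proof (rule AE_pair_measure)
    show "AE x in \<mu>. AE y in \<nu>. 0 \<le> fst (x, y) + snd (x, y)"
      using AEs(1)
    proof eventually_elim
      case (elim x)
      show ?case using AEs(2) by eventually_elim (use elim in simp)
    qed
  qed measurable
  have "(\<integral>z. exp (- \<theta> * z) \<partial>distr ?M borel ?f) = g \<theta> * h \<theta>" if "0 < \<theta>" for \<theta>
  proof -
    have int: "integrable ?M (\<lambda>p. exp (- \<theta> * ?f p))"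
    proof (rule P.integrable_const_bound)
      show "AE p in ?M. norm (exp (- \<theta> * ?f p)) \<le> 1"
        using AE by eventually_elim (use that in simp)
    qed simp
    have "(\<integral>z. exp (- \<theta> * z) \<partial>distr ?M borel ?f) = (\<integral>p. exp (- \<theta> * ?f p) \<partial>?M)"
      by (rule integral_distr) auto
    also have "\<dots> = (\<integral>x. \<integral>y. exp (- \<theta> * ?f (x, y)) \<partial>\<nu> \<partial>\<mu>)"
      by (rule integral_fst'[OF int, symmetric])
    also have "\<dots> = (\<integral>x. exp (- \<theta> * x) * h \<theta> \<partial>\<mu>)"
    proof (rule Bochner_Integration.integral_cong[OF refl])
      fix x
      have "(\<integral>y. exp (- \<theta> * ?f (x, y)) \<partial>\<nu>) = (\<integral>y. exp (- \<theta> * x) * exp (- \<theta> * y) \<partial>\<nu>)"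
        by (simp add: distrib_left exp_add[symmetric])
      also have "\<dots> = exp (- \<theta> * x) * h \<theta>"
        using assms(2) that by (simp add: laplace_law_def)
      finally show "(\<integral>y. exp (- \<theta> * ?f (x, y)) \<partial>\<nu>) = exp (- \<theta> * x) * h \<theta>" .
    qed
    also have "\<dots> = g \<theta> * h \<theta>" using assms(1) that by (simp add: laplace_law_def)
    finally show ?thesis .
  qed
  moreover have "AE z in distr ?M borel ?f. 0 \<le> z" using AE by (subst AE_distr_iff) auto
  ultimately show "laplace_law (distr ?M borel ?f) (\<lambda>\<theta>. g \<theta> * h \<theta>)"
    by (simp add: laplace_law_def P.real_distribution_distr)
qed

lemma laplace_law_power:
  assumes "laplace_law \<mu> g"
  shows "\<exists>\<kappa>. laplace_law \<kappa> (\<lambda>\<theta>. g \<theta> ^ n)"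
proof (induction n)
  case 0
  then show ?case using laplace_law_return by auto
next
  case (Suc n)
  then show ?case using laplace_law_mult[OF assms] by auto
qed

lemma laplace_law_mixture:
  fixes q :: "nat pmf"
  assumes \<kappa>: "\<And>n. laplace_law (\<kappa> n) (g n)"
  shows "laplace_law (measure_pmf q \<bind> \<kappa>) (\<lambda>\<theta>. \<integral>n. g n \<theta> \<partial>q)"
proof -
  have rd: "real_distribution (\<kappa> n)" for n using \<kappa> by (simp add: laplace_law_def)
  have sets: "sets (\<kappa> n) = sets borel" for n
    using rd[of n] by (simp add: real_distribution.events_eq_borel)
  have meas[measurable]: "\<kappa> \<in> measurable (measure_pmf q) (subprob_algebra borel)"
  proof -
    have "prob_space (\<kappa> n)" for n using rd by (simp add: real_distribution_def)
    then have "\<kappa> n \<in> space (subprob_algebra borel)" for n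
      by (simp add: space_subprob_algebra sets prob_space_imp_subprob_space)
    then show ?thesis by simp
  qed
  have s: "sets (measure_pmf q \<bind> \<kappa>) = sets borel"
    by (rule sets_bind) (auto simp: sets)
  have "prob_space (measure_pmf q \<bind> \<kappa>)"
    by (rule measure_pmf.prob_space_bind[OF _ meas])
       (use rd in \<open>auto simp: real_distribution_def\<close>)
  then have dist: "real_distribution (measure_pmf q \<bind> \<kappa>)"
    using s sets_eq_imp_space_eq[OF s] by (simp add: real_distribution_def real_distribution_axioms_def)
  have AE: "AE y in measure_pmf q \<bind> \<kappa>. 0 \<le> y"
    using \<kappa> by (subst AE_bind[OF meas]) (auto simp: laplace_law_def)
  have "(\<integral>y. exp (- \<theta> * y) \<partial>(measure_pmf q \<bind> \<kappa>)) = (\<integral>n. g n \<theta> \<partial>q)" if "0 < \<theta>" for \<theta>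
  proof -
    \<comment> \<open>The truncation makes the integrand bounded by 1 on the whole line, as
      \<open>integral_bind\<close> requires.\<close>
    let ?f = "\<lambda>y::real. exp (- \<theta> * max 0 y)"
    have eq: "(\<integral>y. exp (- \<theta> * y) \<partial>K) = (\<integral>y. ?f y \<partial>K)"
      if "AE y in K. 0 \<le> y" "sets K = sets borel" for K
    proof (rule integral_cong_AE)
      show "AE y in K. exp (- \<theta> * y) = ?f y" using that(1) by eventually_elim simp
    qed (simp_all add: measurable_cong_sets[OF that(2) refl])
    have "(\<integral>y. ?f y \<partial>(measure_pmf q \<bind> \<kappa>)) = (\<integral>n. \<integral>y. ?f y \<partial>\<kappa> n \<partial>q)"
      by (rule integral_bind[where B'=1 and K=borel and B=1, OF _ _ meas])
         (use that rd in \<open>auto simp: real_distribution_def prob_space.emeasure_space_1\<close>)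
    also have "\<dots> = (\<integral>n. g n \<theta> \<partial>q)"
    proof (rule Bochner_Integration.integral_cong[OF refl])
      fix n
      have "AE y in \<kappa> n. 0 \<le> y" "(\<integral>y. exp (- \<theta> * y) \<partial>\<kappa> n) = g n \<theta>"
        using \<kappa>[of n] that unfolding laplace_law_def by blast+
      then show "(\<integral>y. ?f y \<partial>\<kappa> n) = g n \<theta>" using eq[OF _ sets] by metis
    qed
    finally show ?thesis using eq[OF AE s] by simp
  qed
  with AE dist show ?thesis by (simp add: laplace_law_def)
qed

text \<open>This is the law of \<open>U powr c * Z\<close> with \<open>U\<close> uniform and
  independent of \<open>Z\<close>. For a fixed nonzero value of \<open>Z\<close>, at most one value
  of \<open>U\<close> in the unit interval hits \<open>a\<close>. The value 0 is different, since
  \<open>Z\<close> itself may vanish with positive probability.\<close>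

lemma scale_mixture:
  fixes c :: real
  assumes \<zeta>: "laplace_law \<zeta> g" and c: "0 < c"
  defines "U \<equiv> uniform_measure lborel {0<..<1::real}"
  defines "\<rho> \<equiv> distr (U \<Otimes>\<^sub>M \<zeta>) borel (\<lambda>p. fst p powr c * snd p)"
  shows "laplace_law \<rho> (\<lambda>\<theta>. LBINT u:{0<..<1}. g (u powr c * \<theta>))"
    and "a \<noteq> 0 \<Longrightarrow> measure \<rho> {a} = 0"
proof -
  interpret z: real_distribution \<zeta> using \<zeta> by (simp add: laplace_law_def)
  interpret u: prob_space U unfolding U_def by (rule prob_space_uniform_measure) auto
  have [simp, measurable_cong]: "sets U = sets borel" by (simp add: U_def)
  have intU: "(\<integral>u. f u \<partial>U) = (LBINT u:{0<..<1}. f u)" if "f \<in> borel_measurable borel" for f :: "real \<Rightarrow> real"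
  proof -
    have "U = density lborel (\<lambda>u. ennreal (indicator {0<..<1} u))"
      unfolding U_def uniform_measure_def by (simp add: ennreal_indicator divide_ennreal_def)
    then show ?thesis
      using that by (simp add: integral_density set_lebesgue_integral_def)
  qed
  interpret pair_prob_space U \<zeta> ..
  let ?M = "U \<Otimes>\<^sub>M \<zeta>" and ?f = "\<lambda>p. fst p powr c * snd p :: real"
  have AEz: "AE z in \<zeta>. 0 \<le> z" using \<zeta> by (simp add: laplace_law_def)
  have AE: "AE p in ?M. 0 \<le> ?f p"
  proof (rule AE_pair_measure)
    show "AE x in U. AE y in \<zeta>. 0 \<le> fst (x, y) powr c * snd (x, y)"
    proof (rule AE_I2)
      fix x
      show "AE y in \<zeta>. 0 \<le> fst (x, y) powr c * snd (x, y)"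
        using AEz by eventually_elim simp
    qed
  qed measurable
  have "(\<integral>z. exp (- \<theta> * z) \<partial>\<rho>) = (LBINT u:{0<..<1}. g (u powr c * \<theta>))" if "0 < \<theta>" for \<theta>
  proof -
    have int: "integrable ?M (\<lambda>p. exp (- \<theta> * ?f p))"
    proof (rule P.integrable_const_bound)
      show "AE p in ?M. norm (exp (- \<theta> * ?f p)) \<le> 1"
        using AE by eventually_elim (use that in simp)
    qed simp
    have "(\<integral>z. exp (- \<theta> * z) \<partial>\<rho>) = (\<integral>p. exp (- \<theta> * ?f p) \<partial>?M)"
      unfolding \<rho>_def by (rule integral_distr) auto
    also have "\<dots> = (\<integral>x. \<integral>y. exp (- \<theta> * ?f (x, y)) \<partial>\<zeta> \<partial>U)"
      by (rule integral_fst'[OF int, symmetric])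
    also have "\<dots> = (LBINT u:{0<..<1}. \<integral>y. exp (- \<theta> * ?f (u, y)) \<partial>\<zeta>)"
      by (rule intU) measurable
    also have "\<dots> = (LBINT u:{0<..<1}. g (u powr c * \<theta>))"
    proof (rule set_lebesgue_integral_cong)
      show "\<forall>u. u \<in> {0<..<1} \<longrightarrow> (\<integral>y. exp (- \<theta> * ?f (u, y)) \<partial>\<zeta>) = g (u powr c * \<theta>)"
      proof (intro allI impI)
        fix u :: real assume "u \<in> {0<..<1}"
        then have "0 < u powr c * \<theta>" using that by simp
        moreover have "\<forall>\<theta>>0. (\<integral>y. exp (- \<theta> * y) \<partial>\<zeta>) = g \<theta>"
          using \<zeta> unfolding laplace_law_def by blast
        ultimately have "(\<integral>y. exp (- (u powr c * \<theta>) * y) \<partial>\<zeta>) = g (u powr c * \<theta>)" by blast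
        then show "(\<integral>y. exp (- \<theta> * ?f (u, y)) \<partial>\<zeta>) = g (u powr c * \<theta>)" by (simp add: mult_ac)
      qed
    qed simp
    finally show ?thesis .
  qed
  moreover have "AE z in \<rho>. 0 \<le> z" unfolding \<rho>_def using AE by (subst AE_distr_iff) auto
  moreover have "real_distribution \<rho>" unfolding \<rho>_def by (rule P.real_distribution_distr) simp
  ultimately show "laplace_law \<rho> (\<lambda>\<theta>. LBINT u:{0<..<1}. g (u powr c * \<theta>))"
    by (simp add: laplace_law_def)
  assume a: "a \<noteq> 0"
  \<comment> \<open>The claim is clear for fixed \<open>y\<close>, so the quantifiers start in this
    order and are swapped afterwards to match the product measure.\<close>
  have "AE y in \<zeta>. AE x in U. x powr c * y \<noteq> a"
  proof (rule AE_I2)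
    fix y
    have "AE x in lborel. x \<noteq> (a / y) powr (1 / c)" by (rule AE_lborel_singleton)
    then have "AE x in lborel. x \<in> {0<..<1} \<longrightarrow> x powr c * y \<noteq> a"
    proof eventually_elim
      case (elim x)
      show ?case
      proof (intro impI notI)
        assume x: "x \<in> {0<..<1}" "x powr c * y = a"
        with a have "y \<noteq> 0" by auto
        with x have "a / y = x powr c" by auto
        then show False using elim x c by (simp add: powr_powr)
      qed
    qed
    then show "AE x in U. x powr c * y \<noteq> a"
      unfolding U_def by (intro AE_uniform_measureI) auto
  qed
  then have "AE x in U. AE y in \<zeta>. x powr c * y \<noteq> a"
    by (subst AE_commute) measurable
  then have "AE p in ?M. ?f p \<noteq> a"
    by (subst (asm) AE_pair_iff) measurable
  then have "AE z in \<rho>. z \<noteq> a"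
    unfolding \<rho>_def by (subst AE_distr_iff) auto
  then have "AE z in \<rho>. z \<notin> {a}" by simp
  moreover have "{a} \<in> sets \<rho>" by (simp add: \<rho>_def)
  ultimately have "emeasure \<rho> {a} = 0" by (metis AE_iff_null_sets null_setsD1)
  then show "measure \<rho> {a} = 0" by (simp add: measure_def)
qed

section \<open>The limit law\<close>

text \<open>Passing from \<open>k\<close> to \<open>k + 1\<close> multiplies the signed coefficient
  by \<open>(k - 1 - \<alpha>) / (k + 1)\<close>, which is nonnegative for \<open>k\<close> at least
  2 because \<alpha> is at most 1. It is here that this bound on \<alpha> enters.\<close>

lemma gbinomial_sign_nonneg:
  fixes \<alpha> :: real
  assumes "0 < \<alpha>" "\<alpha> \<le> 1" "2 \<le> k"
  shows "0 \<le> (-1) ^ k * ((1 + \<alpha>) gchoose k)"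
  using assms(3)
proof (induction k rule: dec_induct)
  case base
  have "((1 + \<alpha>) gchoose 2) = (1 + \<alpha>) * \<alpha> / 2"
    by (simp add: gbinomial_prod_rev numeral_2_eq_2)
  moreover have "0 \<le> (1 + \<alpha>) * \<alpha> / 2" using assms by simp
  ultimately show ?case by simp
next
  case (step k)
  have eq: "((1 + \<alpha>) gchoose Suc k) = ((1 + \<alpha>) gchoose k) * (1 + \<alpha> - k) / (real k + 1)"
    by (simp add: gbinomial_prod_rev field_simps)
  have "(-1) ^ Suc k * ((1 + \<alpha>) gchoose Suc k)
      = ((-1) ^ k * ((1 + \<alpha>) gchoose k)) * ((real k - 1 - \<alpha>) / (real k + 1))"
    unfolding eq by (simp add: field_simps)
  moreover have "0 \<le> (real k - 1 - \<alpha>) / (real k + 1)" using step assms by simp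
  ultimately show ?case using step.IH by (metis mult_nonneg_nonneg)
qed

text \<open>The binomial series of \<open>(1 - x) powr (1 + \<alpha>)\<close> is stripped of its
  terms of order 0 and 1. What remains has total mass \<alpha> at \<open>x = 1\<close>, whence the
  division by \<alpha>. The result is the branching law of the reduced stable tree; for
  \<open>\<alpha> = 1\<close> it is the point mass at 2.\<close>

lemma stable_offspring_pmf:
  fixes \<alpha> :: real
  assumes \<alpha>: "0 < \<alpha>" "\<alpha> \<le> 1"
  obtains q :: "nat pmf"
  where "\<And>x. 0 \<le> x \<Longrightarrow> x < 1 \<Longrightarrow> (\<integral>n. x ^ n \<partial>q) = ((1 - x) powr (1 + \<alpha>) - 1 + (1 + \<alpha>) * x) / \<alpha>"
proof -
  define p where "p k = (if k < 2 then 0 else (-1) ^ k * ((1 + \<alpha>) gchoose k) / \<alpha>)" for k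
  define Q where "Q x = ((1 - x) powr (1 + \<alpha>) - 1 + (1 + \<alpha>) * x) / \<alpha>" for x
  have p_nonneg: "0 \<le> p k" for k using gbinomial_sign_nonneg[OF \<alpha>, of k] \<alpha> by (simp add: p_def)
  have sums: "(\<lambda>k. p k * x ^ k) sums Q x" if x: "0 \<le> x" "x < 1" for x
  proof -
    let ?f = "\<lambda>k. ((1 + \<alpha>) gchoose k) * (- x) ^ k"
    have "?f sums (1 + (- x)) powr (1 + \<alpha>)"
      by (rule gen_binomial_real) (use x in auto)
    moreover have "(\<lambda>k. if k \<in> {0, 1} then ?f k else 0) sums (\<Sum>k\<in>{0, 1}. ?f k)"
      by (rule sums_If_finite_set) simp
    ultimately have "(\<lambda>k. (?f k - (if k \<in> {0, 1} then ?f k else 0)) / \<alpha>)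
        sums (((1 + (- x)) powr (1 + \<alpha>) - (\<Sum>k\<in>{0, 1}. ?f k)) / \<alpha>)"
      by (intro sums_divide sums_diff)
    also have "(\<lambda>k. (?f k - (if k \<in> {0, 1} then ?f k else 0)) / \<alpha>) = (\<lambda>k. p k * x ^ k)"
      by (auto simp: p_def fun_eq_iff power_minus[of x] less_2_cases_iff)
    also have "((1 + (- x)) powr (1 + \<alpha>) - (\<Sum>k\<in>{0, 1}. ?f k)) / \<alpha> = Q x"
      by (simp add: Q_def)
    finally show ?thesis .
  qed
  have ev01: "eventually (\<lambda>x::real. 0 \<le> x \<and> x < 1) (at_left 1)"
    by (auto simp: eventually_at_left_field intro!: exI[of _ 0])
  have Q1: "(Q \<longlongrightarrow> 1) (at_left 1)"
  proof -
    have "((\<lambda>x::real. 1 - x) \<longlongrightarrow> 0) (at_left 1)"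
      by (rule tendsto_eq_intros refl | simp)+
    then have "((\<lambda>x. (1 - x) powr (1 + \<alpha>)) \<longlongrightarrow> 0 powr (1 + \<alpha>)) (at_left 1)"
      by (rule tendsto_powr') (use \<alpha> in \<open>auto intro: eventually_mono[OF ev01]\<close>)
    then show ?thesis
      unfolding Q_def using \<alpha>
      by (intro tendsto_eq_rhs[OF tendsto_divide[OF tendsto_add[OF tendsto_diff[OF _ tendsto_const]
            tendsto_mult[OF tendsto_const tendsto_ident_at]] tendsto_const]]) auto
  qed
  \<comment> \<open>The series is summed only for \<open>x < 1\<close>. As all terms are
    nonnegative, letting \<open>x\<close> increase to 1 bounds the partial sums and, with the
    reverse estimate below, gives total mass 1.\<close>
  have part: "(\<Sum>k<n. p k) \<le> 1" for n
  proof (rule tendsto_le[OF _ Q1])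
    have "((\<lambda>x. \<Sum>k<n. p k * x ^ k) \<longlongrightarrow> (\<Sum>k<n. p k * 1 ^ k)) (at_left 1)"
      by (intro tendsto_intros)
    then show "((\<lambda>x. \<Sum>k<n. p k * x ^ k) \<longlongrightarrow> (\<Sum>k<n. p k)) (at_left 1)" by simp
    show "\<forall>\<^sub>F x in at_left 1. (\<Sum>k<n. p k * x ^ k) \<le> Q x"
      using ev01
    proof eventually_elim
      case (elim x)
      then show ?case using sums[of x] p_nonneg
        by (intro sum_le_suminf[THEN order.trans]) (auto simp: sums_iff)
    qed
  qed simp
  have summ: "summable p"
    by (rule summableI_nonneg_bounded[OF p_nonneg part])
  have "suminf p = 1"
  proof (rule antisym)
    show "suminf p \<le> 1" by (rule suminf_le_const[OF summ part])
    show "1 \<le> suminf p"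
    proof (rule tendsto_upperbound[OF Q1])
      show "\<forall>\<^sub>F x in at_left 1. Q x \<le> suminf p"
        using ev01
      proof eventually_elim
        case (elim x)
        have "(\<Sum>k. p k * x ^ k) \<le> suminf p"
          using sums[of x] elim p_nonneg
          by (intro suminf_le[OF _ _ summ]) (auto simp: sums_iff mult_left_le power_le_one)
        then show ?case using sums[of x] elim by (simp add: sums_iff)
      qed
    qed simp
  qed
  with summ have p1: "p sums 1" by (simp add: sums_iff)
  have pmf: "pmf (embed_pmf p) k = p k" for k
  proof (rule pmf_embed_pmf)
    show "(\<integral>\<^sup>+k. ennreal (p k) \<partial>count_space UNIV) = 1"
      using suminf_ennreal_eq[OF p_nonneg p1] by (simp add: nn_integral_count_space_nat)
  qed (rule p_nonneg)
  show thesis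
  proof (rule that[of "embed_pmf p"])
    fix x :: real assume x: "0 \<le> x" "x < 1"
    have "(\<integral>n. x ^ n \<partial>embed_pmf p) = (\<integral>n. p n * x ^ n \<partial>count_space UNIV)"
      unfolding measure_pmf_eq_density by (subst integral_density) (simp_all add: pmf p_nonneg)
    also have "\<dots> = (\<Sum>n. p n * x ^ n)"
      using sums[OF x] x p_nonneg
      by (intro integral_count_space_nat) (simp add: integrable_count_space_nat_iff abs_mult sums_iff)
    also have "\<dots> = Q x" using sums[OF x] by (simp add: sums_iff)
    finally show "(\<integral>n. x ^ n \<partial>embed_pmf p) = ((1 - x) powr (1 + \<alpha>) - 1 + (1 + \<alpha>) * x) / \<alpha>"
      by (simp add: Q_def)
  qed
qed

text \<open>With \<open>K = \<theta> powr (- \<alpha>)\<close>, the function \<open>V u\<close> is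
  \<open>1 - h (u powr (1 / \<alpha>) * \<theta>)\<close> for the limit transform \<open>h\<close>.
  Since \<open>V u powr \<alpha> = u / (u + K)\<close>, the integrand is the derivative of
  \<open>u - u * V u\<close>, and only the boundary values 0 and \<open>1 - V 1\<close>
  remain.\<close>

lemma yaglom_scale_identity:
  fixes \<alpha> K :: real
  assumes "0 < \<alpha>" "0 < K"
  defines "V \<equiv> \<lambda>u. (u / (u + K)) powr (1 / \<alpha>)"
  assumes nonneg: "\<And>u. 0 < u \<Longrightarrow> 0 \<le> (V u powr (1 + \<alpha>) - 1 + (1 + \<alpha>) * (1 - V u)) / \<alpha>"
  shows "(LBINT u:{0<..<1}. (V u powr (1 + \<alpha>) - 1 + (1 + \<alpha>) * (1 - V u)) / \<alpha>) = 1 - V 1"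
proof -
  let ?g = "\<lambda>u. (V u powr (1 + \<alpha>) - 1 + (1 + \<alpha>) * (1 - V u)) / \<alpha>"
  let ?W = "\<lambda>u. u - u * V u"
  have V_cont: "isCont V u" if "0 < u" for u
    unfolding V_def using that assms by (auto intro!: continuous_intros)
  have V_pos: "0 < V u" if "0 < u" for u unfolding V_def using that assms by simp
  have d: "DERIV ?W u :> ?g u" if u: "0 < u" for u
  proof -
    have "DERIV (\<lambda>u. u / (u + K)) u :> K / (u + K)\<^sup>2"
      using u assms by (auto intro!: derivative_eq_intros simp: field_simps power2_eq_square)
    then have "DERIV V u :> (1 / \<alpha>) * (u / (u + K)) powr (1 / \<alpha> - 1) * (K / (u + K)\<^sup>2)"
      unfolding V_def using u assms by (intro DERIV_chain2[OF has_real_derivative_powr]) auto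
    then have dV: "DERIV V u :> (1 / \<alpha>) * V u * (K / (u * (u + K)))"
    proof (rule DERIV_cong)
      have "(u / (u + K)) powr (1 / \<alpha> - 1) = V u / (u / (u + K))"
        unfolding V_def using u assms by (simp add: powr_diff)
      then show "(1 / \<alpha>) * (u / (u + K)) powr (1 / \<alpha> - 1) * (K / (u + K)\<^sup>2)
          = (1 / \<alpha>) * V u * (K / (u * (u + K)))"
        using u assms(1,2) by (simp add: power2_eq_square)
    qed
    have "V u powr \<alpha> = u / (u + K)"
      unfolding V_def using u assms by (simp add: powr_powr)
    then have "V u powr (1 + \<alpha>) = V u * (u / (u + K))"
      using V_pos[OF u] by (simp add: powr_add)
    then have g: "?g u = 1 - (V u + u * ((1 / \<alpha>) * V u * (K / (u * (u + K)))))"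
      using u assms by (simp add: divide_simps) (simp add: algebra_simps)
    show ?thesis
      unfolding g by (rule derivative_eq_intros dV refl | simp)+
  qed
  have 0: "((\<lambda>u. u - u * V u) \<longlongrightarrow> 0) (at_right 0)"
  proof (rule tendsto_sandwich[of "\<lambda>_. 0" _ _ "\<lambda>u. u"])
    show "\<forall>\<^sub>F u in at_right 0. 0 \<le> u - u * V u"
      using eventually_at_right_less[of 0]
    proof eventually_elim
      case (elim u)
      have "V u \<le> 1" unfolding V_def using elim assms by (intro powr_le1) auto
      with elim show ?case by (simp add: mult_left_le)
    qed
    show "\<forall>\<^sub>F u in at_right 0. u - u * V u \<le> u"
      using eventually_at_right_less[of 0]
    proof eventually_elim
      case (elim u)
      then show ?case using V_pos[OF elim] by simp
    qed
  qed (auto intro: tendsto_ident_at)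
  have 1: "((\<lambda>u. u - u * V u) \<longlongrightarrow> 1 - V 1) (at_left 1)"
  proof -
    have "(V \<longlongrightarrow> V 1) (at_left 1)"
      using V_cont[of 1] by (auto simp: isCont_def intro: tendsto_within_subset)
    then show ?thesis by (auto intro!: tendsto_eq_intros)
  qed
  \<comment> \<open>Near 0 only the limit of the primitive is at hand. The version of the theorem
    for nonnegative integrands on an open interval asks for no integrability in advance.\<close>
  have "(LBINT u=0..1. ?g u) = (1 - V 1) - 0"
  proof (rule interval_integral_FTC_nonneg(2)[where F="?W"])
    show "isCont ?g u" if "0 < ereal u" for u
      using V_cont[of u] V_pos[of u] that assms by (auto intro!: continuous_intros)
    show "((?W \<circ> real_of_ereal) \<longlongrightarrow> 0) (at_right 0)"
      using 0 by (simp add: ereal_tendsto_simps zero_ereal_def)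
    show "((?W \<circ> real_of_ereal) \<longlongrightarrow> 1 - V 1) (at_left 1)"
      using 1 by (simp add: ereal_tendsto_simps one_ereal_def)
  qed (use d nonneg in auto)
  then show ?thesis by (simp add: interval_lebesgue_integral_def einterval_eq zero_ereal_def one_ereal_def)
qed

text \<open>The transform \<open>h\<close> satisfies \<open>- \<theta> h' = (1 - h) - (1 - h) powr (1 + \<alpha>)\<close>. The binomial series of
  \<open>(1 - h) powr (1 + \<alpha>)\<close> has nonnegative coefficients from the second order on, so integrating the
  equation exhibits \<open>\<mu>\<close> as the law of \<open>U powr (1 / \<alpha>) * Z\<close> with \<open>U\<close> uniform and independent of \<open>Z\<close>, a
  random sum of independent copies. The factor \<open>U\<close> leaves no room for an atom other than \<open>0\<close>.\<close>

lemma yaglom_law_no_atoms: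
  fixes \<alpha> :: real
  assumes \<mu>: "laplace_law \<mu> (\<lambda>\<theta>. 1 - (1 + \<theta> powr (- \<alpha>)) powr (- 1 / \<alpha>))"
    and \<alpha>: "0 < \<alpha>" "\<alpha> \<le> 1"
  shows "measure \<mu> {a} = 0"
proof -
  define h where "h \<theta> = 1 - (1 + \<theta> powr (- \<alpha>)) powr (- 1 / \<alpha>)" for \<theta>
  define g where "g \<theta> = ((1 - h \<theta>) powr (1 + \<alpha>) - 1 + (1 + \<alpha>) * h \<theta>) / \<alpha>" for \<theta>
  have h: "laplace_law \<mu> h" using \<mu> by (simp add: h_def[abs_def])
  interpret real_distribution \<mu> using h by (simp add: laplace_law_def)
  have h01: "0 < h \<theta>" "h \<theta> < 1" if "0 < \<theta>" for \<theta>
  proof -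
    show "0 < h \<theta>" by (rule laplace_law_bounds(1)[OF h that])
    have "0 < 1 + \<theta> powr (- \<alpha>)" by (simp add: add_pos_nonneg)
    then have "0 < (1 + \<theta> powr (- \<alpha>)) powr (- 1 / \<alpha>)" unfolding powr_gt_zero by linarith
    then show "h \<theta> < 1" by (simp add: h_def)
  qed
  obtain q :: "nat pmf" where
    q: "\<And>x. 0 \<le> x \<Longrightarrow> x < 1 \<Longrightarrow> (\<integral>n. x ^ n \<partial>q) = ((1 - x) powr (1 + \<alpha>) - 1 + (1 + \<alpha>) * x) / \<alpha>"
    using stable_offspring_pmf[OF \<alpha>] by blast
  obtain \<kappa> where \<kappa>: "\<And>n. laplace_law (\<kappa> n) (\<lambda>\<theta>. h \<theta> ^ n)"
    using laplace_law_power[OF h] by metis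
  have \<zeta>: "laplace_law (measure_pmf q \<bind> \<kappa>) g"
  proof (rule laplace_law_cong[OF laplace_law_mixture[OF \<kappa>]])
    show "(\<integral>n. h \<theta> ^ n \<partial>q) = g \<theta>" if "0 < \<theta>" for \<theta>
      using h01[OF that] by (simp add: q g_def)
  qed
  define \<rho> where "\<rho> = distr (uniform_measure lborel {0<..<1} \<Otimes>\<^sub>M (measure_pmf q \<bind> \<kappa>)) borel
      (\<lambda>p. fst p powr (1 / \<alpha>) * snd p)"
  have c: "0 < 1 / \<alpha>" using \<alpha> by simp
  have \<rho>: "laplace_law \<rho> (\<lambda>\<theta>. LBINT u:{0<..<1}. g (u powr (1 / \<alpha>) * \<theta>))"
    and \<rho>0: "\<And>a. a \<noteq> 0 \<Longrightarrow> measure \<rho> {a} = 0"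
    unfolding \<rho>_def using scale_mixture[OF \<zeta> c] by auto
  \<comment> \<open>The transform of the scaled random sum is again \<open>h\<close>; uniqueness
    then carries the absence of nonzero atoms over to \<open>\<mu>\<close>.\<close>
  have "laplace_law \<rho> h"
  proof (rule laplace_law_cong[OF \<rho>])
    fix \<theta> :: real assume \<theta>: "0 < \<theta>"
    define K where "K = \<theta> powr (- \<alpha>)"
    have K: "0 < K" using \<theta> by (simp add: K_def)
    define V where "V u = (u / (u + K)) powr (1 / \<alpha>)" for u
    have hV: "h (u powr (1 / \<alpha>) * \<theta>) = 1 - V u" if u: "0 < u" for u
    proof -
      have "(u powr (1 / \<alpha>) * \<theta>) powr (- \<alpha>) = K / u"
        using u \<theta> \<alpha> by (simp add: powr_mult powr_powr K_def powr_minus_divide)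
      moreover have "(1 + K / u) powr (- 1 / \<alpha>) = V u"
      proof -
        have "1 + K / u = (u + K) / u" using u K by (simp add: field_simps)
        then show ?thesis using u K by (simp add: V_def powr_divide powr_minus_divide)
      qed
      ultimately show ?thesis by (simp add: h_def)
    qed
    have gV: "g (u powr (1 / \<alpha>) * \<theta>) = (V u powr (1 + \<alpha>) - 1 + (1 + \<alpha>) * (1 - V u)) / \<alpha>" if "0 < u" for u
      using hV[OF that] by (simp add: g_def)
    have "(LBINT u:{0<..<1}. g (u powr (1 / \<alpha>) * \<theta>))
        = (LBINT u:{0<..<1}. (V u powr (1 + \<alpha>) - 1 + (1 + \<alpha>) * (1 - V u)) / \<alpha>)"
      by (rule set_lebesgue_integral_cong) (auto simp: gV)
    also have "\<dots> = 1 - V 1"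
      unfolding V_def
    proof (rule yaglom_scale_identity[OF \<alpha>(1) K])
      fix u :: real assume u: "0 < u"
      then show "0 \<le> (((u / (u + K)) powr (1 / \<alpha>)) powr (1 + \<alpha>) - 1
          + (1 + \<alpha>) * (1 - (u / (u + K)) powr (1 / \<alpha>))) / \<alpha>"
        using laplace_law_bounds(1)[OF \<zeta>, of "u powr (1 / \<alpha>) * \<theta>"] \<theta> gV[OF u] by (simp add: V_def)
    qed
    also have "\<dots> = h \<theta>" using hV[of 1] by simp
    finally show "(LBINT u:{0<..<1}. g (u powr (1 / \<alpha>) * \<theta>)) = h \<theta>" .
  qed
  then have eq: "\<rho> = \<mu>" using h by (rule laplace_law_unique)
  show ?thesis
  proof (cases "a = 0")
    case True
    \<comment> \<open>Scaling cannot exclude an atom at 0. Its mass is below every value of the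
      transform, and these values tend to 0 at infinity.\<close>
    have "measure \<mu> {0} \<le> h \<theta>" if "0 < \<theta>" for \<theta>
    proof -
      have "measure \<mu> {0} = (\<integral>y. indicator {0} y \<partial>\<mu>)" by simp
      also have "\<dots> \<le> (\<integral>y. exp (- \<theta> * y) \<partial>\<mu>)"
        using laplace_law_integrable[OF h, of \<theta>] that
        by (intro integral_mono) (auto simp: indicator_def intro: integrable_const_bound[where B=1])
      also have "\<dots> = h \<theta>" using h that unfolding laplace_law_def by blast
      finally show ?thesis .
    qed
    then have "\<forall>\<^sub>F \<theta> in at_top. measure \<mu> {0} \<le> h \<theta>"
      using eventually_gt_at_top[of 0] by (rule eventually_mono[rotated])
    moreover have "(h \<longlongrightarrow> 0) at_top"
    proof -
      have "((\<lambda>\<theta>. \<theta> powr (- \<alpha>)) \<longlongrightarrow> 0) at_top"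
        by (rule tendsto_neg_powr[OF _ filterlim_ident]) (use \<alpha> in simp)
      then have "((\<lambda>\<theta>. 1 - (1 + \<theta> powr (- \<alpha>)) powr (- 1 / \<alpha>)) \<longlongrightarrow> 1 - (1 + 0) powr (- 1 / \<alpha>)) at_top"
        by (intro tendsto_intros) auto
      then show ?thesis by (simp add: h_def[abs_def])
    qed
    ultimately have "measure \<mu> {0} \<le> 0" by (intro tendsto_lowerbound) auto
    then show ?thesis using True measure_nonneg[of \<mu> "{0}"] by simp
  next
    case False
    then show ?thesis using \<rho>0 eq by simp
  qed
qed

text \<open>Dropping the inner 1 raises the subtracted power to exactly \<theta>. This limit is what
  keeps mass from escaping in the continuity theorem.\<close>

lemma yaglom_transform_at_0:
  fixes \<alpha> :: real
  assumes "0 < \<alpha>"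
  shows "((\<lambda>\<theta>. 1 - (1 + \<theta> powr (- \<alpha>)) powr (- 1 / \<alpha>)) \<longlongrightarrow> 1) (at_right 0)"
proof -
  have "((\<lambda>\<theta>. (1 + \<theta> powr (- \<alpha>)) powr (- 1 / \<alpha>)) \<longlongrightarrow> 0) (at_right 0)"
  proof (rule tendsto_sandwich[of "\<lambda>_. 0" _ _ "\<lambda>\<theta>. \<theta>"])
    show "\<forall>\<^sub>F \<theta> in at_right 0. (1 + \<theta> powr (- \<alpha>)) powr (- 1 / \<alpha>) \<le> \<theta>"
      using eventually_at_right_less[of 0]
    proof eventually_elim
      case (elim \<theta>)
      have "(1 + \<theta> powr (- \<alpha>)) powr (- 1 / \<alpha>) \<le> (\<theta> powr (- \<alpha>)) powr (- 1 / \<alpha>)"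
        using elim assms by (intro powr_mono2') auto
      also have "\<dots> = \<theta>" using elim assms by (simp add: powr_powr)
      finally show ?case .
    qed
  qed (auto intro: tendsto_ident_at)
  from tendsto_diff[OF tendsto_const[of 1] this] show ?thesis by simp
qed

section \<open>Branching mechanisms and their flows\<close>

text \<open>A Levy measure controls the minimum of \<open>x\<close> and its square, so both a linear
  and a quadratic bound in \<open>y = z * x\<close> are needed. The quadratic one comes from
  \<open>exp (- y) \<le> 1 / (1 + y)\<close>; the factor \<open>max z (z\<^sup>2)\<close> serves
  both.\<close>

lemma levy_integrand_bounds:
  fixes z x :: real
  assumes "0 \<le> z" "0 \<le> x"
  shows "0 \<le> exp (- z * x) - 1 + z * x"
    and "exp (- z * x) - 1 + z * x \<le> max z (z\<^sup>2) * min (x\<^sup>2) x"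
proof -
  define y where "y = z * x"
  have y: "0 \<le> y" using assms by (simp add: y_def)
  have "1 + - y \<le> exp (- y)" by (rule exp_ge_add_one_self)
  then show "0 \<le> exp (- z * x) - 1 + z * x" by (simp add: y_def)
  have "exp (- y) - 1 + y \<le> y" using y by simp
  moreover have "exp (- y) - 1 + y \<le> y\<^sup>2"
  proof -
    have "exp (- y) \<le> 1 / (1 + y)"
      using exp_ge_add_one_self[of y] y by (simp add: exp_minus divide_simps)
    also have "\<dots> \<le> 1 - y + y\<^sup>2"
    proof -
      have "(1 - y + y\<^sup>2) * (1 + y) = 1 + y ^ 3"
        by (simp add: algebra_simps power2_eq_square power3_eq_cube)
      then show ?thesis using y by (simp add: pos_divide_le_eq)
    qed
    finally show ?thesis by simp
  qed
  moreover have "y \<le> max z (z\<^sup>2) * x" "y\<^sup>2 \<le> max z (z\<^sup>2) * x\<^sup>2"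
    unfolding y_def power_mult_distrib using assms by (auto intro!: mult_right_mono)
  ultimately have "exp (- y) - 1 + y \<le> max z (z\<^sup>2) * x" "exp (- y) - 1 + y \<le> max z (z\<^sup>2) * x\<^sup>2"
    by linarith+
  then show "exp (- z * x) - 1 + z * x \<le> max z (z\<^sup>2) * min (x\<^sup>2) x"
    by (simp add: y_def min_def)
qed

lemma levy_integrand_integrable:
  assumes "levy_measure \<Lambda>" "0 \<le> z"
  shows "integrable \<Lambda> (\<lambda>x. exp (- z * x) - 1 + z * x)"
proof (rule Bochner_Integration.integrable_bound)
  have s: "sets \<Lambda> = sets (restrict_space borel {0<..})" using assms by (simp add: levy_measure_def)
  then have sp: "space \<Lambda> = {0<..}" by (simp add: sets_eq_imp_space_eq[OF s] space_restrict_space)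
  show "integrable \<Lambda> (\<lambda>x. max z (z\<^sup>2) * min (x\<^sup>2) x)"
    using assms by (simp add: levy_measure_def)
  show "(\<lambda>x. exp (- z * x) - 1 + z * x) \<in> borel_measurable \<Lambda>"
    unfolding measurable_cong_sets[OF s refl] by (intro measurable_restrict_space1) measurable
  show "AE x in \<Lambda>. norm (exp (- z * x) - 1 + z * x) \<le> norm (max z (z\<^sup>2) * min (x\<^sup>2) x)"
  proof (rule AE_I2)
    fix x assume "x \<in> space \<Lambda>"
    then have "0 \<le> x" by (simp add: sp)
    from levy_integrand_bounds[OF assms(2) this]
    show "norm (exp (- z * x) - 1 + z * x) \<le> norm (max z (z\<^sup>2) * min (x\<^sup>2) x)" by simp
  qed
qed

lemma exp_linear_convex:
  fixes x :: real
  shows "convex_on UNIV (\<lambda>z. exp (- z * x) - 1 + z * x)"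
proof (rule convex_on_realI)
  show "((\<lambda>z. exp (- z * x) - 1 + z * x) has_real_derivative x - x * exp (- z * x)) (at z)" for z
    by (auto intro!: derivative_eq_intros)
  show "x - x * exp (- a * x) \<le> x - x * exp (- b * x)" if "a \<le> b" for a b
  proof (cases "0 \<le> x")
    case True
    with that have "exp (- b * x) \<le> exp (- a * x)" by (simp add: mult_right_mono)
    with True show ?thesis by (simp add: mult_left_mono)
  next
    case False
    with that have "exp (- a * x) \<le> exp (- b * x)" by (simp add: mult_right_mono_neg)
    with False show ?thesis by (simp add: mult_left_mono_neg)
  qed
qed simp

lemma branching_mechanism_zero: "branching_mechanism \<psi> \<Longrightarrow> \<psi> 0 = 0"
  by (auto simp: branching_mechanism_def)

text \<open>Convexity passes from the integrands to \<open>\<psi>\<close>. It supplies both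
  continuity on the open half-line and a linear bound near 0, without differentiating under the
  integral.\<close>

lemma branching_mechanism_convex:
  assumes "branching_mechanism \<psi>"
  shows "convex_on {0..} \<psi>"
proof -
  obtain a b \<Lambda> where b: "0 \<le> b" and \<Lambda>: "levy_measure \<Lambda>"
    and \<psi>: "\<And>z. 0 \<le> z \<Longrightarrow> \<psi> z = a * z + b * z\<^sup>2 + (\<integral>x. (exp (- z * x) - 1 + z * x) \<partial>\<Lambda>)"
    using assms by (auto simp: branching_mechanism_def)
  let ?f = "\<lambda>z x. exp (- z * x) - 1 + z * x :: real"
  show ?thesis
  proof (rule convex_onI)
    fix t x y :: real assume t: "0 < t" "t < 1" and xy: "x \<in> {0..}" "y \<in> {0..}"
    let ?z = "(1 - t) * x + t * y"
    have z: "0 \<le> ?z" using t xy by simp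
    have int: "integrable \<Lambda> (?f x)" "integrable \<Lambda> (?f y)" "integrable \<Lambda> (?f ?z)"
      using xy z by (simp_all only: levy_integrand_integrable[OF \<Lambda>] atLeast_iff)
    have "(\<integral>w. ?f ?z w \<partial>\<Lambda>) \<le> (\<integral>w. (1 - t) * ?f x w + t * ?f y w \<partial>\<Lambda>)"
    proof (rule integral_mono)
      show "?f ?z w \<le> (1 - t) * ?f x w + t * ?f y w" for w
        using convex_onD[OF exp_linear_convex[of w], of t x y] t by simp
    qed (use int in \<open>simp_all del: mult_minus_left\<close>)
    also have "\<dots> = (1 - t) * (\<integral>w. ?f x w \<partial>\<Lambda>) + t * (\<integral>w. ?f y w \<partial>\<Lambda>)"
      using int by (simp del: mult_minus_left)
    finally have I: "(\<integral>w. ?f ?z w \<partial>\<Lambda>) \<le> (1 - t) * (\<integral>w. ?f x w \<partial>\<Lambda>) + t * (\<integral>w. ?f y w \<partial>\<Lambda>)" .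
    have "?z\<^sup>2 \<le> (1 - t) * x\<^sup>2 + t * y\<^sup>2"
    proof -
      have "(1 - t) * x\<^sup>2 + t * y\<^sup>2 - ?z\<^sup>2 = t * (1 - t) * (x - y)\<^sup>2"
        by (simp add: power2_eq_square algebra_simps)
      moreover have "0 \<le> t * (1 - t) * (x - y)\<^sup>2" using t by simp
      ultimately show ?thesis by linarith
    qed
    then have "b * ?z\<^sup>2 \<le> b * ((1 - t) * x\<^sup>2 + t * y\<^sup>2)" using b by (rule mult_left_mono)
    with I have "\<psi> ?z \<le> (1 - t) * \<psi> x + t * \<psi> y"
      using xy z by (simp add: \<psi> algebra_simps del: mult_minus_left)
    then show "\<psi> ((1 - t) *\<^sub>R x + t *\<^sub>R y) \<le> (1 - t) * \<psi> x + t * \<psi> y" by simp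
  qed simp
qed

lemma branching_mechanism_continuous:
  assumes "branching_mechanism \<psi>" shows "continuous_on {0<..} \<psi>"
  by (rule convex_on_continuous)
     (auto intro: convex_on_subset[OF branching_mechanism_convex[OF assms]])

text \<open>The graph lies below its chord from 0 to 1. The bound makes the integral of
  \<open>1 / \<psi>\<close> diverge at 0, so that \<open>G\<close> takes all positive
  values.\<close>

lemma branching_mechanism_le_linear:
  assumes "branching_mechanism \<psi>" "0 < z" "z \<le> 1"
  shows "\<psi> z \<le> \<psi> 1 * z"
  using convex_onD[OF branching_mechanism_convex[OF assms(1)], of z 0 1] assms
  by (simp add: branching_mechanism_zero[OF assms(1)] mult.commute)

section \<open>The primitive of \<open>1 / \<psi>\<close>, the flow and the inverse function\<close>

lemma reciprocal_primitive:
  fixes \<psi> :: "real \<Rightarrow> real"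
  assumes cont: "continuous_on {0<..} \<psi>" and pos: "\<And>z. 0 < z \<Longrightarrow> 0 < \<psi> z"
    and lin: "\<And>z. 0 < z \<Longrightarrow> z \<le> 1 \<Longrightarrow> \<psi> z \<le> C * z"
    and int: "set_integrable lborel {\<theta>\<^sub>0..} (\<lambda>\<xi>. 1 / \<psi> \<xi>)"
  shows "\<exists>G. (\<forall>z>0. (G has_real_derivative - 1 / \<psi> z) (at z)) \<and>
    (G \<longlongrightarrow> 0) at_top \<and> filterlim G at_top (at_right 0)"
proof -
  define a where "a = max 1 \<theta>\<^sub>0"
  let ?f = "\<lambda>\<xi>. 1 / \<psi> \<xi>"
  \<comment> \<open>This is the integral from \<open>z\<close> to infinity, written as a constant
    minus an interval integral so that one differentiation formula covers \<open>z\<close> on both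
    sides of \<open>a\<close>.\<close>
  define G where "G z = (LBINT \<xi>:{a..}. ?f \<xi>) - (LBINT \<xi>=a..z. ?f \<xi>)" for z :: real
  have a: "0 < a" by (simp add: a_def)
  have int_a: "set_integrable lborel {a..} ?f"
    by (rule set_integrable_subset[OF int]) (auto simp: a_def)
  have fcont: "isCont ?f z" if "0 < z" for z
    using cont pos[OF that] that by (auto intro!: continuous_intros simp: continuous_on_eq_continuous_at)
  have deriv: "(G has_real_derivative - 1 / \<psi> z) (at z)" if z: "0 < z" for z
  proof -
    define l u where "l = min z a / 2" and "u = max z a + 1"
    have lu: "0 < l" "l < z" "z < u" "l \<le> a" "a \<le> u" using a z by (auto simp: l_def u_def)
    have "((\<lambda>w. LBINT \<xi>=a..w. ?f \<xi>) has_vector_derivative ?f z) (at z within {l..u})"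
      by (rule interval_integral_FTC2) (use lu fcont in \<open>auto intro!: continuous_at_imp_continuous_on\<close>)
    then have "((\<lambda>w. LBINT \<xi>=a..w. ?f \<xi>) has_real_derivative ?f z) (at z)"
      using lu by (simp add: at_within_Icc_at has_real_derivative_iff_has_vector_derivative)
    then show ?thesis unfolding G_def by (auto intro!: derivative_eq_intros)
  qed
  moreover have "(G \<longlongrightarrow> 0) at_top"
  proof -
    have "((\<lambda>z. LBINT \<xi>:{a..z}. ?f \<xi>) \<longlongrightarrow> (LBINT \<xi>:{a..}. ?f \<xi>)) at_top"
      by (rule tendsto_set_lebesgue_integral_at_top[OF _ int_a]) auto
    moreover have "\<forall>\<^sub>F z::real in at_top. (LBINT \<xi>:{a..z}. ?f \<xi>) = (LBINT \<xi>=a..z. ?f \<xi>)"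
      using eventually_ge_at_top[of a] by eventually_elim (simp add: interval_integral_Icc)
    ultimately have "((\<lambda>z::real. LBINT \<xi>=a..z. ?f \<xi>) \<longlongrightarrow> (LBINT \<xi>:{a..}. ?f \<xi>)) at_top"
      by (rule Lim_transform_eventually)
    from tendsto_diff[OF tendsto_const[of "LBINT \<xi>:{a..}. ?f \<xi>"] this] show ?thesis
      by (simp add: G_def[abs_def])
  qed
  moreover have "filterlim G at_top (at_right 0)"
  proof (rule filterlim_at_top_mono)
    have C: "0 < C" using lin[of 1] pos[of 1] by simp
    show "filterlim (\<lambda>z. G 1 + (1 / C) * (- ln z)) at_top (at_right 0)"
      using C by (intro filterlim_tendsto_add_at_top[OF tendsto_const]
          filterlim_tendsto_pos_mult_at_top[OF tendsto_const])
        (auto simp: filterlim_uminus_at_top ln_at_0)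
    show "\<forall>\<^sub>F z in at_right 0. G 1 + (1 / C) * (- ln z) \<le> G z"
    proof -
      have "\<forall>\<^sub>F z in at_right 0. 0 < z \<and> z < (1::real)"
        by (auto simp: eventually_at_right_field intro!: exI[of _ 1])
      then show ?thesis
      proof eventually_elim
        case (elim z)
        \<comment> \<open>By the linear bound, \<open>1 / \<psi> w\<close> is at least
          \<open>1 / (C * w)\<close> on the unit interval, so adding \<open>ln z / C\<close> to
          \<open>G z\<close> leaves a nonincreasing function: \<open>G\<close> grows at least like a
          logarithm at 0.\<close>
        have "G 1 + (1 / C) * ln 1 \<le> G z + (1 / C) * ln z"
        proof (rule DERIV_nonpos_imp_nonincreasing[where f="\<lambda>z. G z + (1 / C) * ln z"])
          show "z \<le> 1" using elim by simp
          fix w assume w: "z \<le> w" "w \<le> 1"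
          then have "0 < w" using elim by simp
          moreover have "1 / (C * w) \<le> 1 / \<psi> w"
            using \<open>0 < w\<close> w lin[of w] pos[of w] by (intro divide_left_mono) (auto intro: mult_pos_pos C)
          ultimately show "\<exists>y. ((\<lambda>z. G z + 1 / C * ln z) has_real_derivative y) (at w) \<and> y \<le> 0"
            using C by (intro exI[of _ "- 1 / \<psi> w + 1 / C * (1 / w)"])
              (auto intro!: derivative_eq_intros deriv)
        qed
        then show ?case by simp
      qed
    qed
  qed
  ultimately show ?thesis by blast
qed

text \<open>Separation of variables: along the flow \<open>G\<close> has derivative 1 in time,
  because \<open>- 1 / \<psi>\<close> and \<open>- \<psi>\<close> multiply to 1.\<close>

lemma cumulant_flow_primitive:
  assumes G: "\<And>z. 0 < z \<Longrightarrow> (G has_real_derivative - 1 / \<psi> z) (at z)"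
    and \<psi>: "\<And>z. 0 < z \<Longrightarrow> 0 < \<psi> z"
    and u: "cumulant_flow \<psi> u" and t: "0 \<le> t" and z: "0 < z"
  shows "G (u t z) = t + G z"
proof -
  have u0: "u 0 z = z" and upos: "0 < u s z"
    and du: "((\<lambda>s. u s z) has_real_derivative - \<psi> (u s z)) (at s within {0..})" if "0 \<le> s" for s
    using u z that unfolding cumulant_flow_def by blast+
  have "\<exists>c. \<forall>s\<in>{0..}. G (u s z) - s = c"
  proof (rule has_field_derivative_zero_constant)
    fix s :: real assume "s \<in> {0..}"
    then have s: "0 \<le> s" by simp
    have "((\<lambda>s. G (u s z)) has_real_derivative (- 1 / \<psi> (u s z)) * (- \<psi> (u s z))) (at s within {0..})"
      by (rule DERIV_chain'[OF du[OF s] G[OF upos[OF s]]])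
    then show "((\<lambda>s. G (u s z) - s) has_real_derivative 0) (at s within {0..})"
      using \<psi>[OF upos[OF s]] by (auto intro!: derivative_eq_intros)
  qed simp
  then obtain c where c: "\<And>s. 0 \<le> s \<Longrightarrow> G (u s z) - s = c" by auto
  from c[OF t] c[of 0] u0[of 0] show ?thesis by simp
qed

lemma decreasing_inverse:
  fixes G :: "real \<Rightarrow> real"
  assumes dec: "\<And>x y. 0 < x \<Longrightarrow> x < y \<Longrightarrow> G y < G x"
    and cont: "\<And>z. 0 < z \<Longrightarrow> isCont G z"
    and lim: "(G \<longlongrightarrow> 0) at_top" "filterlim G at_top (at_right 0)"
  shows "\<exists>\<phi>. \<forall>t>0. 0 < \<phi> t \<and> G (\<phi> t) = t"
proof -
  have "\<exists>p>0. G p = t" if t: "0 < t" for t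
  proof -
    have "\<forall>\<^sub>F z in at_right 0. t \<le> G z" using lim(2) by (simp add: filterlim_at_top)
    then have "\<forall>\<^sub>F z in at_right 0. t \<le> G z \<and> 0 < z"
      using eventually_at_right_less by (rule eventually_conj)
    from eventually_happens'[OF _ this] obtain a where a: "t \<le> G a" "0 < a" by auto
    have "\<forall>\<^sub>F z in at_top. G z < t \<and> a \<le> z"
      using order_tendstoD(2)[OF lim(1) t] eventually_ge_at_top by (rule eventually_conj)
    from eventually_happens'[OF _ this] obtain b where b: "G b < t" "a \<le> b" by auto
    have "\<exists>p\<ge>a. p \<le> b \<and> G p = t"
      by (rule IVT2') (use a b in \<open>auto intro!: continuous_at_imp_continuous_on cont\<close>)
    then obtain q where "a \<le> q" "G q = t" by blast
    with a show ?thesis by (intro exI[of _ q]) auto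
  qed
  then show ?thesis by metis
qed

lemma one_minus_exp_over_self: "((\<lambda>p::real. (1 - exp (- p)) / p) \<longlongrightarrow> 1) (at 0)"
proof -
  have "((\<lambda>p::real. 1 - exp (- p)) has_real_derivative 1) (at 0)"
    by (auto intro!: derivative_eq_intros)
  then show ?thesis by (simp add: DERIV_def)
qed

text \<open>As \<open>1 - exp (- p)\<close> is equivalent to \<open>p\<close> at 0, the factor
  \<open>x\<close> cancels in the quotient. This is why the limit law does not depend on the
  starting point.\<close>

lemma one_minus_exp_ratio:
  fixes w v :: "'a \<Rightarrow> real"
  assumes w: "filterlim w (at_right 0) F" and v: "filterlim v (at_right 0) F"
    and lim: "((\<lambda>t. w t / v t) \<longlongrightarrow> c) F" and x: "0 < x"
  shows "((\<lambda>t. (1 - exp (- x * w t)) / (1 - exp (- x * v t))) \<longlongrightarrow> c) F"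
proof -
  have ev: "\<forall>\<^sub>F t in F. 0 < w t" "\<forall>\<^sub>F t in F. 0 < v t"
    using w v by (auto simp: filterlim_at elim: eventually_mono)
  have sc: "filterlim (\<lambda>t. x * f t) (at 0) F" if "filterlim f (at_right 0) F" for f :: "'a \<Rightarrow> real"
  proof -
    have "(f \<longlongrightarrow> 0) F" "\<forall>\<^sub>F t in F. 0 < f t" using that by (auto simp: filterlim_at elim: eventually_mono)
    then have "((\<lambda>t. x * f t) \<longlongrightarrow> 0) F" "\<forall>\<^sub>F t in F. x * f t \<noteq> 0"
      using x by (auto intro!: tendsto_eq_intros elim: eventually_mono)
    then show ?thesis by (simp add: filterlim_at)
  qed
  let ?E = "\<lambda>p::real. (1 - exp (- p)) / p"
  have "((\<lambda>t. ?E (x * w t) * (w t / v t) / ?E (x * v t)) \<longlongrightarrow> 1 * c / 1) F"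
    by (intro tendsto_divide tendsto_mult lim filterlim_compose[OF one_minus_exp_over_self] sc w v) auto
  then show ?thesis
  proof (rule Lim_transform_eventually[OF tendsto_eq_rhs])
    show "\<forall>\<^sub>F t in F. ?E (x * w t) * (w t / v t) / ?E (x * v t) = (1 - exp (- x * w t)) / (1 - exp (- x * v t))"
      using ev by eventually_elim (use x in \<open>simp add: divide_simps\<close>)
  qed simp
qed

section \<open>Regular variation\<close>

text \<open>L'Hopital's rule replaces Karamata's theorem, since the derivative of the primitive is known.\<close>

lemma primitive_regularly_varying_at_0:
  fixes \<psi> L :: "real \<Rightarrow> real"
  assumes G: "\<And>z. 0 < z \<Longrightarrow> (G has_real_derivative - 1 / \<psi> z) (at z)"
    and G0: "filterlim G at_top (at_right 0)"
    and L: "slowly_varying L"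
    and \<psi>: "\<And>z. 0 < z \<Longrightarrow> \<psi> z = z powr (1 + \<alpha>) * L (1 / z)"
    and l: "0 < l"
  shows "((\<lambda>z. G (l * z) / G z) \<longlongrightarrow> l powr (- \<alpha>)) (at_right 0)"
proof (rule lhopital_right_0_at_top[OF G0])
  have Lpos: "0 < L x" if "0 < x" for x using L that by (simp add: slowly_varying_def)
  then have \<psi>pos: "0 < \<psi> z" if "0 < z" for z using that by (simp add: \<psi>)
  note ev = eventually_at_right_less[of "0::real"]
  show "\<forall>\<^sub>F z in at_right 0. - 1 / \<psi> z \<noteq> 0"
    using ev by eventually_elim (use \<psi>pos in force)
  show "\<forall>\<^sub>F z in at_right 0. (G has_real_derivative - 1 / \<psi> z) (at z)"
    using ev by eventually_elim (rule G)
  show "\<forall>\<^sub>F z in at_right 0. ((\<lambda>z. G (l * z)) has_real_derivative (- 1 / \<psi> (l * z)) * l) (at z)"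
    using ev
  proof eventually_elim
    case (elim z)
    then have "0 < l * z" using l by simp
    then show ?case by (intro DERIV_chain2[OF G]) (auto intro!: derivative_eq_intros)
  qed
  have inv: "filterlim (\<lambda>z::real. 1 / z) at_top (at_right 0)"
    using filterlim_inverse_at_top_right by (simp add: inverse_eq_divide)
  \<comment> \<open>Variation at 0 with factor \<open>l\<close> becomes variation at infinity with
    factor \<open>1 / l\<close>. The quotient of derivatives is
    \<open>l * \<psi> z / \<psi> (l * z)\<close>, in which the powers of \<open>z\<close>
    cancel.\<close>
  have "((\<lambda>x. L ((1 / l) * x) / L x) \<longlongrightarrow> 1) at_top"
    using L[unfolded slowly_varying_def, THEN conjunct2, THEN conjunct2, rule_format, of "1 / l"] l by simp
  from filterlim_compose[OF this inv]
  have "((\<lambda>z. l powr (- \<alpha>) / (L ((1 / l) * (1 / z)) / L (1 / z))) \<longlongrightarrow> l powr (- \<alpha>) / 1) (at_right 0)"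
    by (intro tendsto_divide tendsto_const) auto
  then show "((\<lambda>z. (- 1 / \<psi> (l * z)) * l / (- 1 / \<psi> z)) \<longlongrightarrow> l powr (- \<alpha>)) (at_right 0)"
  proof (rule Lim_transform_eventually[OF tendsto_eq_rhs])
    show "\<forall>\<^sub>F z in at_right 0. l powr (- \<alpha>) / (L ((1 / l) * (1 / z)) / L (1 / z))
        = (- 1 / \<psi> (l * z)) * l / (- 1 / \<psi> z)"
      using ev
    proof eventually_elim
      case (elim z)
      have "\<psi> (l * z) = l * (l powr \<alpha>) * z powr (1 + \<alpha>) * L (1 / (l * z))"
        using elim l by (simp add: \<psi> powr_mult powr_add)
      moreover have "0 < L (1 / (l * z))" "0 < L (1 / z)" using elim l by (auto intro!: Lpos)
      ultimately show ?case using elim l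
        by (simp add: \<psi>[OF elim] powr_minus field_simps)
    qed
  qed simp
qed

text \<open>Regular variation speaks of fixed multiples. Since \<open>G\<close> is decreasing,
  \<open>w\<close> can be squeezed between multiples \<open>l * v\<close> with \<open>l\<close> near
  \<open>c\<close>, which takes the place of locally uniform convergence.\<close>

lemma ratio_limit_forward:
  fixes G :: "real \<Rightarrow> real"
  assumes dec: "\<And>x y. 0 < x \<Longrightarrow> x < y \<Longrightarrow> G y < G x" and pos: "\<And>x. 0 < x \<Longrightarrow> 0 < G x"
    and rv: "\<And>l. 0 < l \<Longrightarrow> ((\<lambda>z. G (l * z) / G z) \<longlongrightarrow> l powr p) (at_right 0)"
    and v: "filterlim v (at_right 0) F" and c: "0 < c"
    and wv: "((\<lambda>t. w t / v t) \<longlongrightarrow> c) F"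
  shows "((\<lambda>t. G (w t) / G (v t)) \<longlongrightarrow> c powr p) F"
proof (rule order_tendstoI)
  have ev: "\<forall>\<^sub>F t in F. 0 < v t"
    using v by (auto simp: filterlim_at elim: eventually_mono)
  have cont: "((\<lambda>l. l powr p) \<longlongrightarrow> c powr p) (at c)" using c by (auto intro!: tendsto_intros)
  note comp = filterlim_compose[OF rv v]
  fix a assume "a < c powr p"
  then have "\<forall>\<^sub>F l in at_right c. a < l powr p"
    using order_tendstoD(1)[OF tendsto_within_subset[OF cont]] by blast
  then have "\<forall>\<^sub>F l in at_right c. a < l powr p \<and> c < l"
    using eventually_at_right_less by (rule eventually_conj)
  from eventually_happens'[OF _ this] obtain l where l: "a < l powr p" "c < l" by auto
  have l0: "0 < l" using l c by simp
  show "\<forall>\<^sub>F t in F. a < G (w t) / G (v t)"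
    using ev order_tendstoD(1)[OF wv c] order_tendstoD(2)[OF wv l(2)] order_tendstoD(1)[OF comp[OF l0] l(1)]
  proof eventually_elim
    case (elim t)
    then have "w t < l * v t" "0 < w t" by (simp_all add: divide_simps)
    then have "G (l * v t) / G (v t) < G (w t) / G (v t)"
      using dec pos[of "v t"] elim by (simp add: divide_strict_right_mono)
    moreover have "a < G (l * v t) / G (v t)" using elim l c by simp
    ultimately show ?case by linarith
  qed
next
  have ev: "\<forall>\<^sub>F t in F. 0 < v t"
    using v by (auto simp: filterlim_at elim: eventually_mono)
  have cont: "((\<lambda>l. l powr p) \<longlongrightarrow> c powr p) (at c)" using c by (auto intro!: tendsto_intros)
  note comp = filterlim_compose[OF rv v]
  fix a assume "c powr p < a"
  then have "\<forall>\<^sub>F l in at_left c. l powr p < a"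
    using order_tendstoD(2)[OF tendsto_within_subset[OF cont]] by blast
  then have "\<forall>\<^sub>F l in at_left c. l powr p < a \<and> 0 < l \<and> l < c"
    using c by (auto simp: eventually_conj_iff eventually_at_left_field)
  from eventually_happens'[OF _ this] obtain l where l: "l powr p < a" "l < c" "0 < l" by auto
  show "\<forall>\<^sub>F t in F. G (w t) / G (v t) < a"
    using ev order_tendstoD(1)[OF wv l(2)] order_tendstoD(2)[OF comp[OF l(3)] l(1)]
  proof eventually_elim
    case (elim t)
    then have "l * v t < w t" by (simp add: divide_simps)
    then have "G (w t) / G (v t) < G (l * v t) / G (v t)"
      using dec pos[of "v t"] elim l by (simp add: divide_strict_right_mono)
    moreover have "G (l * v t) / G (v t) < a" using elim l c by simp
    ultimately show ?case by linarith
  qed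
qed

text \<open>If \<open>w / v\<close> exceeded some \<open>l\<close> above the claimed limit, then
  \<open>G w / G v\<close> would be at most \<open>G (l * v) / G v\<close>, whose limit
  \<open>l powr (- \<alpha>)\<close> is below \<open>c\<close>; the other side is symmetric. Of
  \<open>w\<close> only positivity is assumed, since its decay is a consequence.\<close>

lemma ratio_limit_backward:
  fixes G :: "real \<Rightarrow> real"
  assumes dec: "\<And>x y. 0 < x \<Longrightarrow> x < y \<Longrightarrow> G y < G x" and pos: "\<And>x. 0 < x \<Longrightarrow> 0 < G x"
    and \<alpha>: "0 < \<alpha>"
    and rv: "\<And>l. 0 < l \<Longrightarrow> ((\<lambda>z. G (l * z) / G z) \<longlongrightarrow> l powr (- \<alpha>)) (at_right 0)"
    and v: "filterlim v (at_right 0) F" and w: "\<forall>\<^sub>F t in F. 0 < w t" and c: "0 < c"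
    and Gwv: "((\<lambda>t. G (w t) / G (v t)) \<longlongrightarrow> c) F"
  shows "((\<lambda>t. w t / v t) \<longlongrightarrow> c powr (- 1 / \<alpha>)) F"
proof -
  define d where "d = c powr (- 1 / \<alpha>)"
  have d: "0 < d" using c by (simp add: d_def)
  have dc: "d powr (- \<alpha>) = c" using c \<alpha> by (simp add: d_def powr_powr)
  have ev: "\<forall>\<^sub>F t in F. 0 < v t" using v by (auto simp: filterlim_at elim: eventually_mono)
  note comp = filterlim_compose[OF rv v]
  have upper: "\<forall>\<^sub>F t in F. w t / v t < l" if l: "d < l" for l
  proof -
    have l0: "0 < l" using l d by simp
    have "l powr (- \<alpha>) < c"
      using powr_less_mono2_neg[OF _ d l, of "- \<alpha>"] \<alpha> by (simp add: dc)
    \<comment> \<open>The threshold \<open>m\<close> separates the two limits, so the two quotients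
      are eventually strictly ordered.\<close>
    then obtain m where m: "l powr (- \<alpha>) < m" "m < c" using dense by blast
    show ?thesis
      using ev w order_tendstoD(2)[OF comp[OF l0] m(1)] order_tendstoD(1)[OF Gwv m(2)]
    proof eventually_elim
      case (elim t)
      then have "G (l * v t) / G (v t) < G (w t) / G (v t)" by linarith
      then have "G (l * v t) < G (w t)" using pos[of "v t"] elim by (simp add: divide_less_cancel)
      then have "w t < l * v t"
        using dec[of "l * v t" "w t"] mult_pos_pos[OF l0, of "v t"] elim by (cases "l * v t" "w t" rule: linorder_cases) auto
      then show ?case using elim by (simp add: divide_simps)
    qed
  qed
  have lower: "\<forall>\<^sub>F t in F. l < w t / v t" if l: "l < d" for l
  proof (cases "0 < l")
    case False
    show ?thesis using ev w by eventually_elim (use False in \<open>simp add: order.strict_trans1[of l 0]\<close>)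
  next
    case l0: True
    have "c < l powr (- \<alpha>)"
      using powr_less_mono2_neg[OF _ l0 l, of "- \<alpha>"] \<alpha> by (simp add: dc)
    then obtain m where m: "c < m" "m < l powr (- \<alpha>)" using dense by blast
    show ?thesis
      using ev w order_tendstoD(1)[OF comp[OF l0] m(2)] order_tendstoD(2)[OF Gwv m(1)]
    proof eventually_elim
      case (elim t)
      then have "G (w t) / G (v t) < G (l * v t) / G (v t)" by linarith
      then have "G (w t) < G (l * v t)" using pos[of "v t"] elim by (simp add: divide_less_cancel)
      then have "l * v t < w t"
        using dec[of "w t" "l * v t"] elim by (cases "l * v t" "w t" rule: linorder_cases) auto
      then show ?case using elim by (simp add: divide_simps)
    qed
  qed
  show ?thesis using order_tendstoI[of d "\<lambda>t. w t / v t" F] upper lower by (simp add: d_def)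
qed

text \<open>Geometric decay along \<open>2\<^sup>n T\<close>, interpolated by the bound on dyadic intervals.\<close>

lemma tendsto_0_doubling:
  fixes g :: "real \<Rightarrow> real"
  assumes pos: "\<And>x. 0 < x \<Longrightarrow> 0 < g x"
    and dbl: "((\<lambda>x. g (2 * x) / g x) \<longlongrightarrow> r) at_top" "r < 1"
    and dyadic: "\<forall>\<^sub>F x in at_top. \<forall>s\<in>{x..2 * x}. g s \<le> K * g x"
  shows "(g \<longlongrightarrow> 0) at_top"
proof -
  obtain r' where r': "r < r'" "r' < 1" using dense[OF dbl(2)] by blast
  have "0 \<le> r"
  proof (rule tendsto_lowerbound[OF dbl(1)])
    show "\<forall>\<^sub>F x in at_top. 0 \<le> g (2 * x) / g x"
      using eventually_gt_at_top[of 0]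
    proof eventually_elim
      case (elim x)
      then show ?case using pos[of x] pos[of "2 * x"] by simp
    qed
  qed simp
  then have r'0: "0 < r'" using r' by simp
  have "\<forall>\<^sub>F x in at_top. 0 < x \<and> g (2 * x) / g x < r' \<and> (\<forall>s\<in>{x..2 * x}. g s \<le> K * g x)"
    using dyadic order_tendstoD(2)[OF dbl(1) r'(1)] eventually_gt_at_top[of 0] by eventually_elim auto
  then obtain T0 where T0: "\<And>x. T0 \<le> x \<Longrightarrow>
      0 < x \<and> g (2 * x) / g x < r' \<and> (\<forall>s\<in>{x..2 * x}. g s \<le> K * g x)"
    by (auto simp: eventually_at_top_linorder)
  define T where "T = T0"
  have T: "0 < T" using T0[of T0] by (simp add: T_def)
  have step: "g (2 * x) \<le> r' * g x" if "T \<le> x" for x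
    using T0[of x] that pos[of x] by (simp add: T_def divide_simps less_imp_le)
  have K: "0 < K"
  proof -
    have "g T \<le> K * g T" using T0[of T] T by (auto simp: T_def)
    then have "1 \<le> K" using pos[OF T] by simp
    then show ?thesis by simp
  qed
  have geo: "g (2 ^ n * T) \<le> r' ^ n * g T" for n
  proof (induction n)
    case (Suc n)
    have "T \<le> 2 ^ n * T" using T by (simp add: mult_le_cancel_right1)
    then have "g (2 * (2 ^ n * T)) \<le> r' * g (2 ^ n * T)" by (rule step)
    also have "\<dots> \<le> r' * (r' ^ n * g T)" using Suc r'0 by simp
    finally show ?case by (simp add: mult.assoc)
  qed simp
  have bound: "g s \<le> K * (r' ^ N * g T)" if s: "2 ^ N * T \<le> s" for s N
  proof -
    have "1 \<le> s / T" using s T order.trans[of T "2 ^ N * T" s] by (simp add: mult_le_cancel_right1)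
    \<comment> \<open>The dyadic level of \<open>s\<close>, which lies between
      \<open>2 ^ n * T\<close> and \<open>2 ^ Suc n * T\<close>. If \<open>s\<close> is beyond
      \<open>2 ^ N * T\<close>, then \<open>n\<close> is at least \<open>N\<close>.\<close>
    define n where "n = nat \<lfloor>log 2 (s / T)\<rfloor>"
    have l0: "0 \<le> log 2 (s / T)" using \<open>1 \<le> s / T\<close> by simp
    have n1: "real n \<le> log 2 (s / T)" and n2: "log 2 (s / T) < real n + 1"
      unfolding n_def using l0 by linarith+
    have sT: "0 < s / T" using \<open>1 \<le> s / T\<close> by linarith
    have "2 powr real n \<le> s / T" using n1 sT by (simp add: le_log_iff)
    then have le: "2 ^ n * T \<le> s" using T by (simp add: powr_realpow pos_le_divide_eq)
    have "s / T < 2 powr (real n + 1)" using n2 sT by (simp add: log_less_iff)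
    then have lt: "s < 2 ^ Suc n * T"
      using T by (simp add: powr_add powr_realpow pos_divide_less_eq mult.commute)
    then have less: "s \<le> 2 * (2 ^ n * T)" by simp
    have "2 ^ N < (2::real) ^ Suc n"
    proof -
      have "2 ^ N * T < 2 ^ Suc n * T" using s lt by linarith
      then show ?thesis using T by simp
    qed
    then have "N < Suc n" by (rule power_less_imp_less_exp[rotated]) simp
    then have "N \<le> n" by simp
    have "T \<le> 2 ^ n * T" using T by (simp add: mult_le_cancel_right1)
    then have "g s \<le> K * g (2 ^ n * T)" using T0[of "2 ^ n * T"] le less by (simp add: T_def)
    also have "\<dots> \<le> K * (r' ^ n * g T)" using geo K by simp
    also have "\<dots> \<le> K * (r' ^ N * g T)"
      using K pos[OF T] r' r'0 \<open>N \<le> n\<close> by (simp add: power_decreasing)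
    finally show ?thesis .
  qed
  have lim: "(\<lambda>N. K * (r' ^ N * g T)) \<longlonglongrightarrow> 0"
    using LIMSEQ_realpow_zero[of r'] r' r'0 by (auto intro!: tendsto_eq_intros)
  show ?thesis
  proof (rule order_tendstoI)
    fix a :: real assume "a < 0"
    show "\<forall>\<^sub>F x in at_top. a < g x"
      using eventually_gt_at_top[of 0]
    proof eventually_elim
      case (elim x)
      from pos[OF this] \<open>a < 0\<close> show ?case by linarith
    qed
  next
    fix a :: real assume "0 < a"
    from order_tendstoD(2)[OF lim this] obtain N where N: "K * (r' ^ N * g T) < a"
      by (auto simp: eventually_sequentially)
    show "\<forall>\<^sub>F x in at_top. g x < a"
      using eventually_ge_at_top[of "2 ^ N * T"]
    proof eventually_elim
      case (elim x)
      from bound[OF this] N show ?case by linarith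
    qed
  qed
qed

lemma powr_dyadic_bound:
  fixes q x s :: real
  assumes "0 < x" "x \<le> s" "s \<le> 2 * x"
  shows "s powr q \<le> 2 powr \<bar>q\<bar> * x powr q"
proof -
  have "s powr q = (s / x) powr q * x powr q" using assms by (simp add: powr_divide)
  moreover have "(s / x) powr q \<le> 2 powr \<bar>q\<bar>"
  proof -
    have "(s / x) powr q \<le> (s / x) powr \<bar>q\<bar>" using assms by (intro powr_mono) auto
    also have "\<dots> \<le> 2 powr \<bar>q\<bar>" using assms by (intro powr_mono2) (auto simp: divide_simps)
    finally show ?thesis .
  qed
  ultimately show ?thesis by (simp add: mult_right_mono)
qed

text \<open>Doubling gives geometric decay when the total exponent is negative, and monotonicity of
  \<open>f\<close> fills the dyadic intervals, in place of Potter's bounds. For a positive exponent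
  the same is applied to the reciprocal.\<close>

lemma monotone_regularly_varying_powr:
  fixes f :: "real \<Rightarrow> real"
  assumes f: "regularly_varying f p" and mono: "\<And>x y. 0 < x \<Longrightarrow> x \<le> y \<Longrightarrow> f y \<le> f x"
  shows "q + p < 0 \<Longrightarrow> ((\<lambda>x. x powr q * f x) \<longlongrightarrow> 0) at_top"
    and "0 < q + p \<Longrightarrow> filterlim (\<lambda>x. x powr q * f x) at_top at_top"
proof -
  have pos: "0 < f x" if "0 < x" for x using f that by (simp add: regularly_varying_def)
  have lim: "((\<lambda>x. f (2 * x) / f x) \<longlongrightarrow> 2 powr p) at_top" using f by (simp add: regularly_varying_def)
  have lim': "((\<lambda>x. ((2 * x) powr q * f (2 * x)) / (x powr q * f x)) \<longlongrightarrow> 2 powr (q + p)) at_top"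
  proof (rule Lim_transform_eventually)
    show "((\<lambda>x. 2 powr q * (f (2 * x) / f x)) \<longlongrightarrow> 2 powr (q + p)) at_top"
      using tendsto_mult[OF tendsto_const lim, of "2 powr q"] by (simp add: powr_add)
    show "\<forall>\<^sub>F x in at_top. 2 powr q * (f (2 * x) / f x) = ((2 * x) powr q * f (2 * x)) / (x powr q * f x)"
      using eventually_gt_at_top[of 0] by eventually_elim (simp add: powr_mult)
  qed
  show "((\<lambda>x. x powr q * f x) \<longlongrightarrow> 0) at_top" if "q + p < 0"
  proof (rule tendsto_0_doubling[OF _ lim'])
    show "2 powr (q + p) < (1::real)" using that powr_less_mono[of "q + p" 0 2] by simp
    show "\<forall>\<^sub>F x in at_top. \<forall>s\<in>{x..2 * x}. s powr q * f s \<le> 2 powr \<bar>q\<bar> * (x powr q * f x)"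
      using eventually_gt_at_top[of 0]
    proof eventually_elim
      case (elim x)
      show ?case
      proof
        fix s assume s: "s \<in> {x..2 * x}"
        have "s powr q * f s \<le> (2 powr \<bar>q\<bar> * x powr q) * f x"
          using s elim pos[of s] by (intro mult_mono powr_dyadic_bound mono) auto
        then show "s powr q * f s \<le> 2 powr \<bar>q\<bar> * (x powr q * f x)" by (simp add: mult.assoc)
      qed
    qed
  qed (use pos in auto)
  show "filterlim (\<lambda>x. x powr q * f x) at_top at_top" if "0 < q + p"
  proof -
    let ?g = "\<lambda>x. inverse (x powr q * f x)"
    have "(?g \<longlongrightarrow> 0) at_top"
    proof (rule tendsto_0_doubling)
      show "((\<lambda>x. ?g (2 * x) / ?g x) \<longlongrightarrow> inverse (2 powr (q + p))) at_top"
        using tendsto_inverse[OF lim'] by (simp add: field_simps)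
      show "inverse (2 powr (q + p)) < (1::real)"
        using that by (simp add: inverse_less_1_iff)
      \<comment> \<open>Any positive number below the limit of \<open>f (2 * x) / f x\<close> would
        do. As \<open>f\<close> is nonincreasing, its least value on a dyadic interval is at the
        right end, and this number times \<open>f x\<close> is eventually a lower bound for
        it.\<close>
      have "2 powr p / 2 < (2 powr p :: real)" by simp
      from order_tendstoD(1)[OF lim this] eventually_gt_at_top[of 0]
      show "\<forall>\<^sub>F x in at_top. \<forall>s\<in>{x..2 * x}. ?g s \<le> (2 powr \<bar>- q\<bar> * (2 / 2 powr p)) * ?g x"
      proof eventually_elim
        case (elim x)
        show ?case
        proof
          fix s assume s: "s \<in> {x..2 * x}"
          have "(2 powr p / 2) * f x \<le> f (2 * x)" using elim pos[of x] by (simp add: divide_simps)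
          also have "\<dots> \<le> f s" using s elim by (intro mono) auto
          finally have "inverse (f s) \<le> inverse ((2 powr p / 2) * f x)"
            using pos[of x] elim by (intro le_imp_inverse_le) auto
          moreover have "s powr (- q) \<le> 2 powr \<bar>- q\<bar> * x powr (- q)"
            using s elim by (intro powr_dyadic_bound) auto
          ultimately have "s powr (- q) * inverse (f s)
              \<le> (2 powr \<bar>- q\<bar> * x powr (- q)) * inverse ((2 powr p / 2) * f x)"
            using pos[of s] s elim by (intro mult_mono) auto
          then show "?g s \<le> (2 powr \<bar>- q\<bar> * (2 / 2 powr p)) * ?g x"
            by (simp add: powr_minus field_simps)
        qed
      qed
    qed (use pos in auto)
    then have "filterlim ?g (at_right 0) at_top"
      by (rule tendsto_imp_filterlim_at_right)
         (use pos in \<open>auto intro!: eventually_mono[OF eventually_gt_at_top[of 0]] mult_pos_pos\<close>)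
    from filterlim_compose[OF filterlim_inverse_at_top_right this] show ?thesis by simp
  qed
qed

lemma regularly_varying_cong_ratio:
  assumes f: "regularly_varying f p" and g: "\<And>x. 0 < x \<Longrightarrow> 0 < g x"
    and lim: "((\<lambda>x. g x / f x) \<longlongrightarrow> 1) at_top"
  shows "regularly_varying g p"
  unfolding regularly_varying_def
proof (intro conjI allI impI)
  fix z :: real assume z: "0 < z"
  have pos: "0 < f x" if "0 < x" for x using f that by (simp add: regularly_varying_def)
  have "filterlim (\<lambda>x. z * x) at_top at_top"
    using z by (intro filterlim_tendsto_pos_mult_at_top[OF tendsto_const _ filterlim_ident])
  from filterlim_compose[OF lim this]
  have "((\<lambda>x. (g (z * x) / f (z * x)) * (f (z * x) / f x) / (g x / f x)) \<longlongrightarrow> 1 * z powr p / 1) at_top"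
    using f z lim by (intro tendsto_divide tendsto_mult) (auto simp: regularly_varying_def)
  then show "((\<lambda>x. g (z * x) / g x) \<longlongrightarrow> z powr p) at_top"
  proof (rule Lim_transform_eventually[OF tendsto_eq_rhs])
    show "\<forall>\<^sub>F x in at_top. (g (z * x) / f (z * x)) * (f (z * x) / f x) / (g x / f x) = g (z * x) / g x"
      using eventually_gt_at_top[of 0]
    proof eventually_elim
      case (elim x)
      with pos[of x] pos[of "z * x"] z show ?case by (simp add: less_imp_neq[symmetric])
    qed
  qed simp
qed (rule g)

section \<open>Extinction\<close>

context cb_process
begin

lemma space_P: "0 < x \<Longrightarrow> space (P x) = space (P 1)"
  by (rule sets_eq_imp_space_eq[OF sets_P])

lemma natural_filtration_subset:
  assumes x: "0 < x"
  shows "sets (natural_filtration (space (P x)) X r) \<subseteq> sets (P x)"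
proof -
  have "sigma_sets (space (P x)) {X s -` B \<inter> space (P x) |s B. 0 \<le> s \<and> ennreal s \<le> r \<and> B \<in> sets borel}
      \<subseteq> sets (P x)"
    by (rule sets.sigma_sets_subset) (use measurable_sets[OF measurable_X[OF x]] in auto)
  then show ?thesis
    unfolding natural_filtration_def by (subst sets_measure_of) auto
qed

lemma measurable_natural_filtration:
  assumes "0 \<le> s" "ennreal s \<le> r"
  shows "X s \<in> borel_measurable (natural_filtration \<Omega> X r)"
proof (rule measurableI)
  fix B :: "real set" assume "B \<in> sets borel"
  moreover have "space (natural_filtration \<Omega> X r) = \<Omega>"
    by (rule filtration.space_F[OF filtration_natural_filtration])
  ultimately show "X s -` B \<inter> space (natural_filtration \<Omega> X r) \<in> sets (natural_filtration \<Omega> X r)"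
    using assms unfolding natural_filtration_def
    by (subst sets_measure_of) (auto intro!: sigma_sets.Basic exI[of _ s])
qed simp

text \<open>This is the Markov property at a fixed time: the strong Markov property is applied to a
  constant stopping time, whose stopped sigma-algebra is that of the filtration at
  \<open>q\<close>.\<close>

lemma markov_exp:
  assumes x: "0 < x" and q: "0 \<le> q" "q \<le> t"
    and law: "\<And>y s. 0 < y \<Longrightarrow> 0 \<le> s \<Longrightarrow> (\<integral>\<omega>. exp (- X s \<omega>) \<partial>P y) = exp (- y * v s)"
    and A: "A \<in> sets (natural_filtration (space (P x)) X (ennreal q))"
  shows "(\<integral>\<omega>\<in>A. exp (- X t \<omega>) \<partial>P x) = (\<integral>\<omega>\<in>A. exp (- X q \<omega> * v (t - q)) \<partial>P x)"
proof -
  interpret prob_space "P x" using x by (rule prob_space_P)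
  let ?F = "natural_filtration (space (P x)) X"
  interpret fl: filtration "space (P x)" ?F by (rule filtration_natural_filtration)
  \<comment> \<open>The strong Markov property is stated for functions bounded on the whole line,
    hence the absolute value; on the states of the process it changes nothing.\<close>
  let ?T = "\<lambda>\<omega>::'w. ennreal q" and ?f = "\<lambda>y::real. exp (- \<bar>y\<bar>)"
  have T: "stopping_time ?F ?T" by (rule stopping_time_const)
  have sets_pre: "sets (fl.pre_sigma ?T) = sets (?F (ennreal q))"
    unfolding fl.sets_pre_sigma[OF T]
  proof safe
    fix B assume "\<forall>t. {\<omega> \<in> B. ennreal q \<le> t} \<in> sets (?F t)"
    from this[rule_format, of "ennreal q"] show "B \<in> sets (?F (ennreal q))" by simp
  next
    fix B t assume "B \<in> sets (?F (ennreal q))"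
    then show "{\<omega> \<in> B. ennreal q \<le> t} \<in> sets (?F t)"
      using fl.sets_F_mono[of "ennreal q" t] by (cases "ennreal q \<le> t") auto
  qed
  have sub: "subalgebra (P x) (fl.pre_sigma ?T)"
    using natural_filtration_subset[OF x] by (simp add: subalgebra_def fl.space_pre_sigma sets_pre)
  interpret fs: finite_measure_subalgebra "P x" "fl.pre_sigma ?T"
    by standard (rule sub)
  have mX[measurable]: "X s \<in> borel_measurable (P x)" if "0 \<le> s" for s
    using measurable_X[OF x that] .
  have int: "integrable (P x) (\<lambda>\<omega>. ?f (X t \<omega>))"
    using q by (intro integrable_const_bound[where B=1]) auto
  \<comment> \<open>At the trap 0 both sides equal 1; elsewhere \<open>law\<close> gives the
    transition.\<close>
  have trans: "transition P X (t - q) ?f (X q \<omega>) = exp (- X q \<omega> * v (t - q))" if \<omega>: "\<omega> \<in> space (P x)" for \<omega>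
  proof (cases "X q \<omega> = 0")
    case False
    then have y: "0 < X q \<omega>" using X_nonneg[OF q(1), of \<omega>] \<omega> space_P[OF x] by simp
    have "(\<integral>\<omega>'. ?f (X (t - q) \<omega>') \<partial>P (X q \<omega>)) = (\<integral>\<omega>'. exp (- X (t - q) \<omega>') \<partial>P (X q \<omega>))"
      using q X_nonneg[of "t - q"] space_P[OF y] by (intro Bochner_Integration.integral_cong) auto
    also have "\<dots> = exp (- X q \<omega> * v (t - q))" using law[OF y] q by simp
    finally show ?thesis using False by (simp add: transition_def)
  qed (simp add: transition_def)
  have "AE \<omega> in P x. ?T \<omega> < \<infinity> \<longrightarrow>
      real_cond_exp (P x) (fl.pre_sigma ?T)
        (\<lambda>\<omega>'. if ?T \<omega>' < \<infinity> then ?f (X (enn2real (?T \<omega>') + (t - q)) \<omega>') else 0) \<omega>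
      = transition P X (t - q) ?f (X (enn2real (?T \<omega>)) \<omega>)"
  proof (rule strong_markov[OF x T])
    show "bounded (range ?f)" by (auto simp: bounded_iff intro!: exI[of _ 1])
  qed (use q in auto)
  then have "AE \<omega> in P x. real_cond_exp (P x) (fl.pre_sigma ?T) (\<lambda>\<omega>. ?f (X t \<omega>)) \<omega>
      = transition P X (t - q) ?f (X q \<omega>)"
    using q by simp
  then have ce: "AE \<omega> in P x. real_cond_exp (P x) (fl.pre_sigma ?T) (\<lambda>\<omega>. ?f (X t \<omega>)) \<omega>
      = exp (- X q \<omega> * v (t - q))"
    using AE_space by eventually_elim (use trans in simp)
  have A': "A \<in> sets (fl.pre_sigma ?T)" using A by (simp add: sets_pre)
  have AM: "A \<in> sets (P x)" using A natural_filtration_subset[OF x] by auto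
  have "(\<integral>\<omega>\<in>A. exp (- X t \<omega>) \<partial>P x) = (\<integral>\<omega>\<in>A. ?f (X t \<omega>) \<partial>P x)"
    using q X_nonneg[of t] space_P[OF x] sets.sets_into_space[OF AM]
    by (intro set_lebesgue_integral_cong[OF AM]) auto
  also have "\<dots> = (\<integral>\<omega>\<in>A. real_cond_exp (P x) (fl.pre_sigma ?T) (\<lambda>\<omega>. ?f (X t \<omega>)) \<omega> \<partial>P x)"
    by (rule fs.real_cond_exp_intA[OF int A'])
  also have "\<dots> = (\<integral>\<omega>\<in>A. exp (- X q \<omega> * v (t - q)) \<partial>P x)"
    by (rule set_lebesgue_integral_cong_AE[OF AM]) (use ce q in \<open>auto elim: eventually_mono\<close>)
  finally show ?thesis .
qed

text \<open>A maximal inequality: decompose according to the first time of the finite set at which the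
  path lies below \<open>\<epsilon>\<close>.\<close>

lemma below_level_finite:
  assumes x: "0 < x" and S: "finite S" "S \<subseteq> {0..t}" and \<epsilon>: "0 < \<epsilon>"
    and law: "\<And>y s. 0 < y \<Longrightarrow> 0 \<le> s \<Longrightarrow> (\<integral>\<omega>. exp (- X s \<omega>) \<partial>P y) = exp (- y * v s)"
    and v: "\<And>s. 0 \<le> s \<Longrightarrow> 0 \<le> v s \<and> v s \<le> 1"
  shows "(\<integral>\<omega>\<in>{\<omega> \<in> space (P x). \<exists>q\<in>S. X q \<omega> < \<epsilon>}. (1 - exp (- X t \<omega>)) \<partial>P x) \<le> 1 - exp (- \<epsilon>)"
proof (cases "S = {}")
  case False
  then have t: "0 \<le> t" using S by auto
  interpret prob_space "P x" using x by (rule prob_space_P)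
  let ?F = "natural_filtration (space (P x)) X"
  have spF: "space (?F r) = space (P x)" for r
    by (rule filtration.space_F[OF filtration_natural_filtration])
  have mX[measurable]: "X s \<in> borel_measurable (P x)" if "0 \<le> s" for s
    using measurable_X[OF x that] .
  have Xpos: "0 \<le> X s \<omega>" if "0 \<le> s" "\<omega> \<in> space (P x)" for s \<omega>
    using X_nonneg that space_P[OF x] by simp
  define A where "A q = {\<omega> \<in> space (P x). X q \<omega> < \<epsilon> \<and> (\<forall>r\<in>S. r < q \<longrightarrow> \<epsilon> \<le> X r \<omega>)}" for q
  have A_F: "A q \<in> sets (?F (ennreal q))" if q: "q \<in> S" for q
  proof -
    have "A q = {\<omega> \<in> space (?F (ennreal q)). X q \<omega> < \<epsilon>} \<inter>
        {\<omega> \<in> space (?F (ennreal q)). \<forall>r\<in>{r \<in> S. r < q}. \<epsilon> \<le> X r \<omega>}"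
      by (auto simp: A_def spF)
    moreover have [measurable]: "X r \<in> borel_measurable (?F (ennreal q))" if "r \<in> S" "r \<le> q" for r
      using that S q by (intro measurable_natural_filtration) (auto simp: ennreal_leI)
    have "{\<omega> \<in> space (?F (ennreal q)). X q \<omega> < \<epsilon>} \<in> sets (?F (ennreal q))"
      using q by measurable
    moreover have "{\<omega> \<in> space (?F (ennreal q)). \<forall>r\<in>{r \<in> S. r < q}. \<epsilon> \<le> X r \<omega>} \<in> sets (?F (ennreal q))"
      by (rule sets.sets_Collect_finite_All) (use S in \<open>auto intro!: borel_measurable_le\<close>)
    ultimately show ?thesis by auto
  qed
  have A_M: "A q \<in> sets (P x)" if "q \<in> S" for q
    using A_F[OF that] natural_filtration_subset[OF x] by auto
  have un: "{\<omega> \<in> space (P x). \<exists>q\<in>S. X q \<omega> < \<epsilon>} = (\<Union>q\<in>S. A q)"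
  proof safe
    fix \<omega> q assume \<omega>: "\<omega> \<in> space (P x)" "q \<in> S" "X q \<omega> < \<epsilon>"
    let ?m = "Min {q \<in> S. X q \<omega> < \<epsilon>}"
    have fin: "finite {q \<in> S. X q \<omega> < \<epsilon>}" "{q \<in> S. X q \<omega> < \<epsilon>} \<noteq> {}" using S \<omega> by auto
    have "?m \<in> {q \<in> S. X q \<omega> < \<epsilon>}" using Min_in[OF fin] .
    moreover have "\<epsilon> \<le> X r \<omega>" if "r \<in> S" "r < ?m" for r
    proof (rule ccontr)
      assume "\<not> \<epsilon> \<le> X r \<omega>"
      with that fin have "?m \<le> r" by (intro Min_le) auto
      with that show False by simp
    qed
    ultimately show "\<omega> \<in> (\<Union>q\<in>S. A q)" using \<omega> by (auto simp: A_def)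
  qed (auto simp: A_def)
  have disj: "disjoint_family_on A S"
    unfolding disjoint_family_on_def
  proof safe
    fix q r \<omega> assume *: "q \<in> S" "r \<in> S" "q \<noteq> r" "\<omega> \<in> A q" "\<omega> \<in> A r"
    then show "\<omega> \<in> {}" by (cases q r rule: linorder_cases) (force simp: A_def)+
  qed
  have intX: "integrable (P x) (\<lambda>\<omega>. exp (- (X s \<omega> * c)))" if "0 \<le> s" "0 \<le> c" for s c
    using that Xpos by (intro integrable_const_bound[where B=1]) auto
  have intX1: "integrable (P x) (\<lambda>\<omega>. exp (- X t \<omega>))" using intX[OF t, of 1] by simp
  \<comment> \<open>Under the integral over \<open>A q\<close>, \<open>exp (- X t \<omega>)\<close>
    may be replaced by \<open>exp (- X q \<omega> * v (t - q))\<close>. Its exponent is at most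
    \<epsilon> in size, because \<open>X q \<omega>\<close> is below \<epsilon> and \<open>v\<close>
    is at most 1.\<close>
  have part: "(\<integral>\<omega>\<in>A q. (1 - exp (- X t \<omega>)) \<partial>P x) \<le> (1 - exp (- \<epsilon>)) * prob (A q)" if q: "q \<in> S" for q
  proof -
    have q0: "0 \<le> q" "q \<le> t" using S q by auto
    have vq: "0 \<le> v (t - q)" "v (t - q) \<le> 1" using v[of "t - q"] q0 by auto
    have si: "set_integrable (P x) (A q) (\<lambda>\<omega>. exp (- X t \<omega>))"
      "set_integrable (P x) (A q) (\<lambda>\<omega>. exp (- X q \<omega> * v (t - q)))"
      "set_integrable (P x) (A q) (\<lambda>\<omega>. 1::real)" "set_integrable (P x) (A q) (\<lambda>\<omega>. 1 - exp (-\<epsilon>))"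
      using intX1 intX[OF q0(1) vq(1)] A_M[OF q] unfolding set_integrable_def
      by (auto intro!: integrable_mult_indicator simp del: real_scaleR_def)
    have "(\<integral>\<omega>\<in>A q. (1 - exp (- X t \<omega>)) \<partial>P x) = (\<integral>\<omega>\<in>A q. 1 \<partial>P x) - (\<integral>\<omega>\<in>A q. exp (- X t \<omega>) \<partial>P x)"
      using si by (intro set_integral_diff)
    also have "\<dots> = (\<integral>\<omega>\<in>A q. 1 \<partial>P x) - (\<integral>\<omega>\<in>A q. exp (- X q \<omega> * v (t - q)) \<partial>P x)"
      using markov_exp[OF x q0 law A_F[OF q]] by simp
    also have "\<dots> = (\<integral>\<omega>\<in>A q. (1 - exp (- X q \<omega> * v (t - q))) \<partial>P x)"
      using si by (intro set_integral_diff(2)[symmetric])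
    also have "\<dots> \<le> (\<integral>\<omega>\<in>A q. (1 - exp (- \<epsilon>)) \<partial>P x)"
    proof (rule set_integral_mono)
      fix \<omega> assume "\<omega> \<in> A q"
      then have "X q \<omega> \<le> \<epsilon>" "0 \<le> X q \<omega>" using Xpos[OF q0(1)] by (auto simp: A_def)
      then have "X q \<omega> * v (t - q) \<le> \<epsilon> * 1" using vq \<epsilon> by (intro mult_mono) auto
      then show "1 - exp (- X q \<omega> * v (t - q)) \<le> 1 - exp (- \<epsilon>)" by simp
    qed (use si in auto)
    also have "\<dots> = (1 - exp (- \<epsilon>)) * prob (A q)"
      using A_M[OF q] by (simp add: set_lebesgue_integral_def)
    finally show ?thesis .
  qed
  have "(\<integral>\<omega>\<in>(\<Union>q\<in>S. A q). (1 - exp (- X t \<omega>)) \<partial>P x) = (\<Sum>q\<in>S. \<integral>\<omega>\<in>A q. (1 - exp (- X t \<omega>)) \<partial>P x)"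
    by (rule set_integral_finite_Union)
       (use S disj A_M intX1 in \<open>auto simp: set_integrable_def intro!: integrable_mult_indicator simp del: real_scaleR_def\<close>)
  also have "\<dots> \<le> (\<Sum>q\<in>S. (1 - exp (- \<epsilon>)) * prob (A q))" by (rule sum_mono) (rule part)
  also have "\<dots> = (1 - exp (- \<epsilon>)) * prob (\<Union>q\<in>S. A q)"
    using S A_M disj by (subst finite_measure_finite_Union) (auto simp: sum_distrib_left)
  \<comment> \<open>The pieces are disjoint, so the bound is free of the size of \<open>S\<close>
    and survives the passage to countably many times.\<close>
  also have "\<dots> \<le> (1 - exp (- \<epsilon>)) * 1" using \<epsilon> by (intro mult_left_mono) auto
  finally show ?thesis by (simp add: un)
qed (use \<epsilon> in \<open>simp add: set_lebesgue_integral_def\<close>)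

text \<open>On the event of coming below every level, the integral of
  \<open>1 - exp (- X t \<omega>)\<close> is at most \<open>1 - exp (- \<epsilon>)\<close> for every
  \<epsilon>, so it is 0. Rational times keep the event measurable.\<close>

lemma absorbed:
  assumes x: "0 < x" and t: "0 \<le> t"
    and law: "\<And>y s. 0 < y \<Longrightarrow> 0 \<le> s \<Longrightarrow> (\<integral>\<omega>. exp (- X s \<omega>) \<partial>P y) = exp (- y * v s)"
    and v: "\<And>s. 0 \<le> s \<Longrightarrow> 0 \<le> v s \<and> v s \<le> 1"
  shows "AE \<omega> in P x. (\<forall>\<epsilon>>0. \<exists>q\<in>\<rat> \<inter> {0..t}. X q \<omega> < \<epsilon>) \<longrightarrow> X t \<omega> = 0"
proof -
  interpret prob_space "P x" using x by (rule prob_space_P)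
  have mX[measurable]: "X s \<in> borel_measurable (P x)" if "0 \<le> s" for s
    using measurable_X[OF x that] .
  have Xpos: "0 \<le> X s \<omega>" if "0 \<le> s" "\<omega> \<in> space (P x)" for s \<omega>
    using X_nonneg that space_P[OF x] by simp
  let ?Q = "\<rat> \<inter> {0..t}" and ?f = "\<lambda>\<omega>. 1 - exp (- X t \<omega>)"
  have Q: "countable ?Q" "?Q \<noteq> {}" using t countable_rat by (auto intro!: countable_Int1 exI[of _ 0])
  have e: "range (from_nat_into ?Q) = ?Q" by (rule range_from_nat_into[OF Q(2,1)])
  have eQ: "from_nat_into ?Q i \<in> ?Q" for i using e by blast
  have f_pos: "0 \<le> ?f \<omega>" if "\<omega> \<in> space (P x)" for \<omega> using Xpos[OF t that] by simp
  have int: "integrable (P x) ?f" using t Xpos by (intro integrable_const_bound[where B=1]) auto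
  define B where "B \<epsilon> n = {\<omega> \<in> space (P x). \<exists>q\<in>from_nat_into ?Q ` {..<n}. X q \<omega> < \<epsilon>}" for \<epsilon> and n :: nat
  define C where "C \<epsilon> = {\<omega> \<in> space (P x). \<exists>q\<in>?Q. X q \<omega> < \<epsilon>}" for \<epsilon>
  define N where "N = {\<omega> \<in> space (P x). \<forall>\<epsilon>>0. \<exists>q\<in>?Q. X q \<omega> < \<epsilon>}"
  have lev: "{\<omega> \<in> space (P x). X q \<omega> < \<epsilon>} \<in> sets (P x)" if "q \<in> ?Q" for q \<epsilon>
    using that measurable_X[OF x, of q] by (intro borel_measurable_less) auto
  have B_M: "B \<epsilon> n \<in> sets (P x)" for \<epsilon> n
    unfolding B_def by (rule sets.sets_Collect_finite_Ex) (use lev eQ in auto)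
  have C_M: "C \<epsilon> \<in> sets (P x)" for \<epsilon>
    unfolding C_def by (rule sets.sets_Collect_countable_Ex'[OF lev Q(1)])
  have CB: "C \<epsilon> = (\<Union>n. B \<epsilon> n)" for \<epsilon>
  proof
    show "C \<epsilon> \<subseteq> (\<Union>n. B \<epsilon> n)"
    proof
      fix \<omega> assume "\<omega> \<in> C \<epsilon>"
      then obtain q where q: "\<omega> \<in> space (P x)" "q \<in> ?Q" "X q \<omega> < \<epsilon>" by (auto simp: C_def)
      then obtain i where "q = from_nat_into ?Q i" using e by (metis imageE)
      with q have "\<omega> \<in> B \<epsilon> (Suc i)" by (auto simp: B_def)
      then show "\<omega> \<in> (\<Union>n. B \<epsilon> n)" by blast
    qed
    show "(\<Union>n. B \<epsilon> n) \<subseteq> C \<epsilon>" using eQ by (fastforce simp: B_def C_def)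
  qed
  have C_bound: "(\<integral>\<omega>\<in>C \<epsilon>. ?f \<omega> \<partial>P x) \<le> 1 - exp (- \<epsilon>)" if \<epsilon>: "0 < \<epsilon>" for \<epsilon>
  proof (rule LIMSEQ_le_const2)
    show "(\<lambda>n. \<integral>\<omega>\<in>B \<epsilon> n. ?f \<omega> \<partial>P x) \<longlonglongrightarrow> (\<integral>\<omega>\<in>C \<epsilon>. ?f \<omega> \<partial>P x)"
      unfolding CB
    proof (rule set_integral_cont_up)
      show "incseq (B \<epsilon>)" by (fastforce simp: incseq_def B_def)
      show "set_integrable (P x) (\<Union>n. B \<epsilon> n) ?f"
        unfolding CB[symmetric] set_integrable_def by (rule integrable_mult_indicator[OF C_M int])
    qed (rule B_M)
    have "(\<integral>\<omega>\<in>B \<epsilon> n. ?f \<omega> \<partial>P x) \<le> 1 - exp (- \<epsilon>)" for n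
      unfolding B_def by (rule below_level_finite[OF x _ _ \<epsilon> law v]) (use eQ in auto)
    then show "\<exists>N. \<forall>n\<ge>N. (\<integral>\<omega>\<in>B \<epsilon> n. ?f \<omega> \<partial>P x) \<le> 1 - exp (- \<epsilon>)" by blast
  qed
  have NC: "N = (\<Inter>m. C (1 / real (Suc m)))"
  proof safe
    fix \<omega> m assume "\<omega> \<in> N" then show "\<omega> \<in> C (1 / real (Suc m))" by (simp add: N_def C_def)
  next
    fix \<omega> assume w: "\<omega> \<in> (\<Inter>m. C (1 / real (Suc m)))"
    have "\<exists>q\<in>?Q. X q \<omega> < \<epsilon>" if \<epsilon>: "0 < \<epsilon>" for \<epsilon>
    proof -
      obtain m where "1 / real (Suc m) < \<epsilon>" using nat_approx_posE[OF \<epsilon>] .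
      moreover have "\<omega> \<in> C (1 / real (Suc m))" using w by blast
      ultimately show ?thesis unfolding C_def by force
    qed
    moreover have "\<omega> \<in> space (P x)" using w by (auto simp: C_def)
    ultimately show "\<omega> \<in> N" by (simp add: N_def)
  qed
  have N_M: "N \<in> sets (P x)" unfolding NC using C_M by auto
  have si: "set_integrable (P x) A ?f" if "A \<in> sets (P x)" for A
    unfolding set_integrable_def by (rule integrable_mult_indicator[OF that int])
  have le: "(\<integral>\<omega>\<in>N. ?f \<omega> \<partial>P x) \<le> 1 - exp (- \<epsilon>)" if \<epsilon>: "0 < \<epsilon>" for \<epsilon>
  proof -
    have "N \<subseteq> C \<epsilon>" using \<epsilon> by (auto simp: N_def C_def)
    then have "(\<integral>\<omega>\<in>N. ?f \<omega> \<partial>P x) \<le> (\<integral>\<omega>\<in>C \<epsilon>. ?f \<omega> \<partial>P x)"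
      unfolding set_lebesgue_integral_def
      using si[OF N_M] si[OF C_M] f_pos
      by (intro integral_mono) (auto simp: set_integrable_def indicator_def)
    with C_bound[OF \<epsilon>] show ?thesis by linarith
  qed
  have "(\<integral>\<omega>\<in>N. ?f \<omega> \<partial>P x) \<le> 0"
  proof (rule tendsto_lowerbound)
    show "((\<lambda>\<epsilon>. 1 - exp (- \<epsilon>)) \<longlongrightarrow> (0::real)) (at_right 0)"
      by (auto intro!: tendsto_eq_intros)
    show "\<forall>\<^sub>F \<epsilon> in at_right 0. (\<integral>\<omega>\<in>N. ?f \<omega> \<partial>P x) \<le> 1 - exp (- \<epsilon>)"
      using eventually_at_right_less[of "0::real"] by eventually_elim (rule le)
  qed simp
  moreover have nn: "AE \<omega> in P x. 0 \<le> indicator N \<omega> *\<^sub>R ?f \<omega>"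
    using f_pos by (auto simp: indicator_def)
  ultimately have "(\<integral>\<omega>. indicator N \<omega> *\<^sub>R ?f \<omega> \<partial>P x) = 0"
    using integral_nonneg_AE[OF nn] by (simp add: set_lebesgue_integral_def)
  then have "AE \<omega> in P x. indicator N \<omega> *\<^sub>R ?f \<omega> = 0"
    using integral_nonneg_eq_0_iff_AE[OF si[OF N_M, unfolded set_integrable_def] nn] by simp
  then show ?thesis
    using AE_space by eventually_elim (auto simp: N_def indicator_def split: if_splits)
qed

text \<open>A pathwise fact: by right continuity, a zero before time \<open>t\<close> makes the path
  small at rational times just after it.\<close>

lemma extinction_before_imp_near_zero:
  assumes \<omega>: "\<omega> \<in> space (P 1)" and t: "0 \<le> t" and ext: "extinction_time X \<omega> \<le> ennreal t"
    and pos: "X t \<omega> \<noteq> 0" and \<epsilon>: "0 < \<epsilon>"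
  shows "\<exists>q\<in>\<rat> \<inter> {0..t}. X q \<omega> < \<epsilon>"
proof (cases "\<exists>s. 0 \<le> s \<and> s \<le> t \<and> X s \<omega> = 0")
  case True
  then obtain s where s: "0 \<le> s" "s \<le> t" "X s \<omega> = 0" by blast
  with pos have st: "s < t" by (cases "s = t") auto
  have "((\<lambda>r. X r \<omega>) \<longlongrightarrow> 0) (at_right s)"
    using right_continuous[OF s(1) \<omega>] s by (simp add: continuous_within)
  from order_tendstoD(2)[OF this \<epsilon>] obtain b where b: "s < b" "\<And>r. s < r \<Longrightarrow> r < b \<Longrightarrow> X r \<omega> < \<epsilon>"
    by (auto simp: eventually_at_right_field)
  obtain q where "q \<in> \<rat>" "s < q" "q < min b t" using Rats_dense_in_real[of s "min b t"] b st by auto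
  with b s show ?thesis by (intro bexI[of _ q]) auto
next
  \<comment> \<open>Without a zero up to time \<open>t\<close>, an infimum of at most
    \<open>t\<close> would force zeros arbitrarily close to \<open>t\<close> from the right. This
    contradicts right continuity at \<open>t\<close>, where the path is positive.\<close>
  case False
  have Xt: "0 < X t \<omega>" using X_nonneg[OF t \<omega>] pos by simp
  have "((\<lambda>r. X r \<omega>) \<longlongrightarrow> X t \<omega>) (at_right t)"
    using right_continuous[OF t \<omega>] by (simp add: continuous_within)
  from order_tendstoD(1)[OF this Xt] obtain b where b: "t < b" "\<And>r. t < r \<Longrightarrow> r < b \<Longrightarrow> 0 < X r \<omega>"
    by (auto simp: eventually_at_right_field)
  have "ennreal t < ennreal b" using b t by (simp add: ennreal_lessI)
  with ext have "Inf {ennreal t |t. 0 \<le> t \<and> X t \<omega> = 0} < ennreal b"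
    unfolding extinction_time_def by (rule order.strict_trans1)
  then obtain s where s: "0 \<le> s" "X s \<omega> = 0" "ennreal s < ennreal b" by (auto simp: Inf_less_iff)
  then have "s < b" by (simp add: ennreal_less_iff)
  moreover have "t < s" using False s by (metis not_less)
  ultimately show ?thesis using b(2) s by force
qed

text \<open>The event on the left need not lie in the sigma-algebra of \<open>P x\<close>, hence the
  almost sure form. A path extinct by time \<open>t\<close> and yet positive there would have come
  arbitrarily near 0, which \<open>absorbed\<close> excludes outside a null set.\<close>

lemma survives_iff_positive:
  assumes x: "0 < x" and t: "0 \<le> t"
    and law: "\<And>y s. 0 < y \<Longrightarrow> 0 \<le> s \<Longrightarrow> (\<integral>\<omega>. exp (- X s \<omega>) \<partial>P y) = exp (- y * v s)"
    and v: "\<And>s. 0 \<le> s \<Longrightarrow> 0 \<le> v s \<and> v s \<le> 1"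
  shows "AE \<omega> in P x. ennreal t < extinction_time X \<omega> \<longleftrightarrow> 0 < X t \<omega>"
proof -
  have "AE \<omega> in P x. (\<forall>\<epsilon>>0. \<exists>q\<in>\<rat> \<inter> {0..t}. X q \<omega> < \<epsilon>) \<longrightarrow> X t \<omega> = 0"
    by (rule absorbed[OF x t]) (use law v in auto)
  then show ?thesis
    using AE_space
  proof eventually_elim
    case (elim \<omega>)
    then have \<omega>: "\<omega> \<in> space (P 1)" using space_P[OF x] by simp
    show ?case
    proof
      assume "ennreal t < extinction_time X \<omega>"
      moreover have "extinction_time X \<omega> \<le> ennreal t" if "X t \<omega> = 0"
        unfolding extinction_time_def using t that by (intro Inf_lower) auto
      ultimately show "0 < X t \<omega>" using X_nonneg[OF t \<omega>] by force
    next
      assume "0 < X t \<omega>"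
      with elim(1) extinction_before_imp_near_zero[OF \<omega> t] show "ennreal t < extinction_time X \<omega>"
        by (metis less_irrefl not_less)
    qed
  qed
qed

end

section \<open>Conditioning on survival\<close>

lemma measure_completion_AE_eq:
  assumes AE: "AE \<omega> in M. \<omega> \<in> A \<longleftrightarrow> \<omega> \<in> B" and B: "B \<in> sets M" and A: "A \<subseteq> space M"
  shows "measure (completion M) A = measure M B"
proof -
  have AEc: "AE \<omega> in completion M. \<omega> \<in> B \<longleftrightarrow> \<omega> \<in> A"
    using AE_completion[OF AE] by eventually_elim auto
  have Bc: "B \<in> sets (completion M)" using B by simp
  \<comment> \<open>\<open>A\<close> is not assumed measurable; being almost everywhere equal to a
    measurable set, it belongs to the completion.\<close>
  have Ac: "A \<in> sets (completion M)"
    by (rule completion.in_sets_AE[OF AEc Bc]) (use A in simp)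
  have "measure (completion M) A = measure (completion M) B"
    by (rule measure_eq_AE[OF _ Ac Bc]) (use AEc in \<open>auto elim: eventually_mono\<close>)
  also have "\<dots> = measure M B" using B by (rule measure_completion)
  finally show ?thesis .
qed

lemma (in prob_space) integral_uniform_measure:
  fixes f :: "'a \<Rightarrow> real"
  assumes A: "A \<in> events" "0 < prob A" and f: "f \<in> borel_measurable M"
  shows "(\<integral>x. f x \<partial>uniform_measure M A) = (\<integral>x\<in>A. f x \<partial>M) / prob A"
proof -
  have "uniform_measure M A = density M (\<lambda>x. ennreal (indicator A x / prob A))"
    unfolding uniform_measure_def using A
    by (intro density_cong AE_I2) (auto simp: emeasure_eq_measure indicator_def divide_ennreal[of 1, simplified])
  then have "(\<integral>x. f x \<partial>uniform_measure M A) = (\<integral>x. (indicator A x / prob A) *\<^sub>R f x \<partial>M)"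
    using A f by (simp add: integral_density)
  also have "\<dots> = (\<integral>x\<in>A. f x \<partial>M) / prob A"
    by (simp add: set_lebesgue_integral_def)
  finally show ?thesis .
qed

text \<open>As \<open>z\<close> grows, \<open>exp (- z * X t \<omega>)\<close> decreases to the
  indicator of \<open>X t \<omega> = 0\<close>, so dominated convergence reads the probability of
  that event off the limit \<open>p\<close>. The second part subtracts this event.\<close>

lemma (in cb_process) positive_prob:
  assumes x: "0 < x" and t: "0 \<le> t"
    and law: "\<And>z. 0 < z \<Longrightarrow> (\<integral>\<omega>. exp (- z * X t \<omega>) \<partial>P x) = exp (- x * w z)"
    and lim: "(w \<longlongrightarrow> p) at_top"
  shows "measure (P x) {\<omega> \<in> space (P x). 0 < X t \<omega>} = 1 - exp (- x * p)"
    and "0 < z \<Longrightarrow> (\<integral>\<omega>\<in>{\<omega> \<in> space (P x). 0 < X t \<omega>}. exp (- z * X t \<omega>) \<partial>P x)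
           = exp (- x * w z) - exp (- x * p)"
proof -
  interpret prob_space "P x" using x by (rule prob_space_P)
  have mX[measurable]: "X t \<in> borel_measurable (P x)" using measurable_X[OF x t] .
  have Xpos: "0 \<le> X t \<omega>" if "\<omega> \<in> space (P x)" for \<omega>
    using X_nonneg[OF t] that space_P[OF x] by simp
  let ?A = "{\<omega> \<in> space (P x). 0 < X t \<omega>}" and ?Z = "{\<omega> \<in> space (P x). X t \<omega> = 0}"
  have "(\<lambda>n. \<integral>\<omega>. exp (- real (Suc n) * X t \<omega>) \<partial>P x) \<longlonglongrightarrow> (\<integral>\<omega>. indicator ?Z \<omega> \<partial>P x)"
  proof (rule integral_dominated_convergence[where w="\<lambda>_. 1"])
    show "AE \<omega> in P x. (\<lambda>n. exp (- real (Suc n) * X t \<omega>)) \<longlonglongrightarrow> indicator ?Z \<omega>"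
    proof (rule AE_I2)
      fix \<omega> assume \<omega>: "\<omega> \<in> space (P x)"
      show "(\<lambda>n. exp (- real (Suc n) * X t \<omega>)) \<longlonglongrightarrow> indicator ?Z \<omega>"
      proof (cases "X t \<omega> = 0")
        case False
        with Xpos[OF \<omega>] have "exp (- X t \<omega>) < 1" by simp
        then have "(\<lambda>n. exp (- X t \<omega>) ^ Suc n) \<longlonglongrightarrow> 0"
          by (intro LIMSEQ_Suc LIMSEQ_realpow_zero) auto
        moreover have "exp (- real (Suc n) * X t \<omega>) = exp (- X t \<omega>) ^ Suc n" for n
          by (simp only: exp_of_nat_mult[symmetric] mult_minus_left mult_minus_right)
        ultimately show ?thesis using False by (simp only: indicator_simps mem_Collect_eq) simp
      qed (use \<omega> in simp)
    qed
    show "AE \<omega> in P x. norm (exp (- real (Suc n) * X t \<omega>)) \<le> 1" for n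
      using Xpos by (intro AE_I2) (auto intro!: mult_nonneg_nonneg simp del: of_nat_Suc)
  qed auto
  moreover have "(\<lambda>n. \<integral>\<omega>. exp (- real (Suc n) * X t \<omega>) \<partial>P x) \<longlonglongrightarrow> exp (- x * p)"
  proof -
    have "(\<lambda>n. w (real (Suc n))) \<longlonglongrightarrow> p"
      by (rule filterlim_compose[OF lim filterlim_compose[OF filterlim_real_sequentially filterlim_Suc]])
    then have "(\<lambda>n. exp (- x * w (real (Suc n)))) \<longlonglongrightarrow> exp (- x * p)"
      by (intro tendsto_intros)
    moreover have "(\<integral>\<omega>. exp (- real (Suc n) * X t \<omega>) \<partial>P x) = exp (- x * w (real (Suc n)))" for n
      by (rule law) simp
    ultimately show ?thesis by presburger
  qed
  ultimately have "(\<integral>\<omega>. indicator ?Z \<omega> \<partial>P x) = exp (- x * p)"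
    by (rule LIMSEQ_unique)
  then have Z: "prob ?Z = exp (- x * p)" by simp
  have "?A = space (P x) - ?Z" using Xpos by force
  then show "prob ?A = 1 - exp (- x * p)"
    using prob_compl[of ?Z] Z by simp
  assume z: "0 < z"
  have int: "integrable (P x) (\<lambda>\<omega>. exp (- z * X t \<omega>))"
    using Xpos z by (intro integrable_const_bound[where B=1]) auto
  have "(\<integral>\<omega>\<in>?A. exp (- z * X t \<omega>) \<partial>P x) = (\<integral>\<omega>. exp (- z * X t \<omega>) - indicator ?Z \<omega> \<partial>P x)"
    unfolding set_lebesgue_integral_def
  proof (rule Bochner_Integration.integral_cong[OF refl])
    fix \<omega> assume "\<omega> \<in> space (P x)"
    with Xpos[OF this] show "indicator ?A \<omega> *\<^sub>R exp (- z * X t \<omega>) = exp (- z * X t \<omega>) - indicator ?Z \<omega>"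
      by (auto simp: indicator_def)
  qed
  also have "\<dots> = exp (- x * w z) - prob ?Z"
  proof -
    have "integrable (P x) (indicator ?Z :: 'w \<Rightarrow> real)"
      by (intro integrable_const_bound[where B=1]) auto
    from Bochner_Integration.integral_diff[OF int this] show ?thesis
      using law[OF z] by simp
  qed
  finally show "(\<integral>\<omega>\<in>?A. exp (- z * X t \<omega>) \<partial>P x) = exp (- x * w z) - exp (- x * p)" by (simp add: Z)
qed

text \<open>The transform is written as 1 minus a quotient so that
  \<open>one_minus_exp_ratio\<close> applies to it.\<close>

lemma (in cb_process) conditional_laplace_law:
  assumes x: "0 < x" and t: "0 \<le> t"
    and law: "\<And>z. 0 < z \<Longrightarrow> (\<integral>\<omega>. exp (- z * X t \<omega>) \<partial>P x) = exp (- x * w z)"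
    and lim: "(w \<longlongrightarrow> p) at_top" and p: "0 < p" and c: "0 < c"
  defines "A \<equiv> {\<omega> \<in> space (P x). 0 < X t \<omega>}"
  defines "N \<equiv> distr (uniform_measure (P x) A) borel (\<lambda>\<omega>. c * X t \<omega>)"
  shows "laplace_law N (\<lambda>\<theta>. 1 - (1 - exp (- x * w (\<theta> * c))) / (1 - exp (- x * p)))"
    and "cdf N y = measure (P x) (A \<inter> {\<omega> \<in> space (P x). c * X t \<omega> \<le> y}) / measure (P x) A"
proof -
  interpret prob_space "P x" using x by (rule prob_space_P)
  have mX[measurable]: "X t \<in> borel_measurable (P x)" using measurable_X[OF x t] .
  have Xpos: "0 \<le> X t \<omega>" if "\<omega> \<in> space (P x)" for \<omega>
    using X_nonneg[OF t] that space_P[OF x] by simp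
  have A[measurable]: "A \<in> events" unfolding A_def by measurable
  have pA: "prob A = 1 - exp (- x * p)" unfolding A_def by (rule positive_prob(1)[OF x t law lim])
  have pA0: "0 < prob A" unfolding pA using x p by simp
  have emA: "emeasure (P x) A \<noteq> 0" "emeasure (P x) A \<noteq> \<infinity>"
    using pA0 by (auto simp: emeasure_eq_measure)
  interpret U: prob_space "uniform_measure (P x) A" by (rule prob_space_uniform_measure[OF emA])
  have "(\<integral>y. exp (- \<theta> * y) \<partial>N) = 1 - (1 - exp (- x * w (\<theta> * c))) / (1 - exp (- x * p))" if \<theta>: "0 < \<theta>" for \<theta>
  proof -
    have "(\<integral>y. exp (- \<theta> * y) \<partial>N) = (\<integral>\<omega>. exp (- \<theta> * (c * X t \<omega>)) \<partial>uniform_measure (P x) A)"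
      unfolding N_def by (rule integral_distr) auto
    also have "\<dots> = (\<integral>\<omega>\<in>A. exp (- \<theta> * (c * X t \<omega>)) \<partial>P x) / prob A"
      by (rule integral_uniform_measure[OF A pA0]) measurable
    also have "(\<integral>\<omega>\<in>A. exp (- \<theta> * (c * X t \<omega>)) \<partial>P x) = exp (- x * w (\<theta> * c)) - exp (- x * p)"
      using positive_prob(2)[OF x t law lim, of "\<theta> * c"] \<theta> c unfolding A_def by (simp add: mult.assoc)
    also have "(exp (- x * w (\<theta> * c)) - exp (- x * p)) / prob A
        = 1 - (1 - exp (- x * w (\<theta> * c))) / (1 - exp (- x * p))"
    proof -
      have *: "(a - b) / (1 - b) = 1 - (1 - a) / (1 - b)" if "1 - b \<noteq> 0" for a b :: real
        using that by (simp add: field_simps)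
      have "1 - exp (- x * p) \<noteq> 0" using pA0 unfolding pA by linarith
      then show ?thesis unfolding pA by (rule *)
    qed
    finally show ?thesis .
  qed
  moreover have "AE y in N. 0 \<le> y"
  proof -
    have "AE \<omega> in uniform_measure (P x) A. 0 \<le> c * X t \<omega>"
      by (rule AE_uniform_measureI[OF A]) (use c in \<open>auto simp: A_def\<close>)
    then show ?thesis unfolding N_def by (subst AE_distr_iff) auto
  qed
  moreover have "real_distribution N" unfolding N_def by (rule U.real_distribution_distr) simp
  ultimately show "laplace_law N (\<lambda>\<theta>. 1 - (1 - exp (- x * w (\<theta> * c))) / (1 - exp (- x * p)))"
    by (simp add: laplace_law_def)
  have "cdf N y = measure (uniform_measure (P x) A) {\<omega> \<in> space (P x). c * X t \<omega> \<le> y}"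
    unfolding cdf_def N_def by (subst measure_distr) (auto intro!: arg_cong2[where f=measure])
  also have "\<dots> = prob (A \<inter> {\<omega> \<in> space (P x). c * X t \<omega> \<le> y}) / prob A"
    by (rule measure_uniform_measure[OF emA]) measurable
  finally show "cdf N y = prob (A \<inter> {\<omega> \<in> space (P x). c * X t \<omega> \<le> y}) / prob A" .
qed

section \<open>The conditional limit theorem\<close>

theorem theorem1:
  fixes P :: "real \<Rightarrow> 'w measure" and X :: "real \<Rightarrow> 'w \<Rightarrow> real"
    and \<psi> L :: "real \<Rightarrow> real" and \<alpha> :: real
  assumes "cb_process P X"
    and "has_branching_mechanism P X \<psi>"
    and "critical \<psi>"
    and "\<exists>\<theta>\<^sub>0>0. set_integrable lborel {\<theta>\<^sub>0..} (\<lambda>\<xi>. 1 / \<psi> \<xi>)"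
    and "0 < \<alpha>" and "\<alpha> \<le> 1"
    and "slowly_varying L"
    and "\<And>z. 0 < z \<Longrightarrow> \<psi> z = z powr (1 + \<alpha>) * L (1 / z)"
  shows "(\<exists>\<mu>. real_distribution \<mu> \<and> measure \<mu> {0..} = 1 \<and>
            (\<forall>x>0. \<forall>y\<ge>0.
               ((\<lambda>t. \<P>(\<omega> in completion (P x).
                        survival P X t * X t \<omega> \<le> y \<bar> ennreal t < extinction_time X \<omega>))
                 \<longlongrightarrow> cdf \<mu> y) at_top) \<and>
            (\<forall>\<theta>>0. (LINT y:{0..}|\<mu>. exp (- \<theta> * y)) =
                     1 - (1 + \<theta> powr (- \<alpha>)) powr (- 1 / \<alpha>)))
       \<and> regularly_varying (survival P X) (- 1 / \<alpha>)
       \<and> (\<forall>\<delta>>0. filterlim (\<lambda>t. t powr (1 / \<alpha> + \<delta>) * survival P X t) at_top at_top)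
       \<and> (\<forall>\<delta>>0. ((\<lambda>t. t powr (1 / \<alpha> - \<delta>) * survival P X t) \<longlongrightarrow> 0) at_top)"
proof -
  interpret cb_process P X by (rule assms(1))
  note \<alpha> = assms(5,6) and L = assms(7) and \<psi>_eq = assms(8)
  obtain u where bm: "branching_mechanism \<psi>" and u: "cumulant_flow \<psi> u"
    and law_all: "\<forall>x>0. \<forall>t\<ge>0. \<forall>z>0. (\<integral>\<omega>. exp (- z * X t \<omega>) \<partial>P x) = exp (- x * u t z)"
    using assms(2) unfolding has_branching_mechanism_def by (elim conjE exE)
  note law = law_all[rule_format]
  obtain \<theta>\<^sub>0 where \<theta>\<^sub>0: "set_integrable lborel {\<theta>\<^sub>0..} (\<lambda>\<xi>. 1 / \<psi> \<xi>)" using assms(4) by blast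
  have \<psi>pos: "0 < \<psi> z" if "0 < z" for z
    using L that by (simp add: \<psi>_eq slowly_varying_def)
  obtain G where G_all: "\<forall>z>0. (G has_real_derivative - 1 / \<psi> z) (at z)"
    and Ginf: "(G \<longlongrightarrow> 0) at_top" and G0: "filterlim G at_top (at_right 0)"
    using reciprocal_primitive[OF branching_mechanism_continuous[OF bm] \<psi>pos
        branching_mechanism_le_linear[OF bm] \<theta>\<^sub>0] by blast
  note G = G_all[rule_format]
  have dec: "G y < G x" if "0 < x" "x < y" for x y
  proof (rule DERIV_neg_imp_decreasing[OF that(2)])
    fix z assume "x \<le> z"
    then have "0 < z" using that by simp
    then show "\<exists>d. (G has_real_derivative d) (at z) \<and> d < 0"
      using G \<psi>pos by (intro exI[of _ "- 1 / \<psi> z"]) auto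
  qed
  have Gpos: "0 < G x" if "0 < x" for x
  proof -
    have "0 \<le> G (x + 1)"
    proof (rule tendsto_upperbound[OF Ginf])
      show "\<forall>\<^sub>F z in at_top. G z \<le> G (x + 1)"
        using eventually_gt_at_top[of "x + 1"]
        by eventually_elim (use dec[of "x + 1"] that in \<open>simp add: less_imp_le\<close>)
    qed simp
    with dec[of x "x + 1"] that show ?thesis by simp
  qed
  have less_if_G_greater: "x < y" if "G y < G x" "0 < x" "0 < y" for x y
    using dec[of y x] that by (cases x y rule: linorder_cases) auto
  have rv: "((\<lambda>z. G (l * z) / G z) \<longlongrightarrow> l powr (- \<alpha>)) (at_right 0)" if "0 < l" for l
    by (rule primitive_regularly_varying_at_0[OF G G0 L \<psi>_eq that])
  obtain \<phi> where \<phi>_all: "\<forall>t>0. 0 < \<phi> t \<and> G (\<phi> t) = t"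
    using decreasing_inverse[OF dec DERIV_isCont[OF G] Ginf G0] by blast
  note \<phi> = \<phi>_all[rule_format]
  have upos: "0 < u t z" if "0 \<le> t" "0 < z" for t z
    using u that unfolding cumulant_flow_def by blast
  have Gu: "G (u t z) = t + G z" if "0 \<le> t" "0 < z" for t z
    by (rule cumulant_flow_primitive[OF G \<psi>pos u that])
  have u_le: "u t z \<le> z" if "0 \<le> t" "0 < z" for t z
    using Gu[OF that] that(1) dec[OF that(2), of "u t z"] by fastforce
  \<comment> \<open>The comparison is made through \<open>G\<close>:
    \<open>G (u t z) = t + G z\<close> tends to \<open>t = G (\<phi> t)\<close>, and monotonicity of
    \<open>G\<close> carries the inequalities back.\<close>
  have u_lim: "((\<lambda>z. u t z) \<longlongrightarrow> \<phi> t) at_top" if t: "0 < t" for t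
  proof (rule order_tendstoI)
    have lim: "((\<lambda>z. t + G z) \<longlongrightarrow> t) at_top" using Ginf by (auto intro!: tendsto_eq_intros)
    fix a assume a: "a < \<phi> t"
    show "\<forall>\<^sub>F z in at_top. a < u t z"
    proof (cases "0 < a")
      case True
      then have "t < G a" using dec[OF True a] \<phi>[OF t] by simp
      from order_tendstoD(2)[OF lim this] eventually_gt_at_top[of 0] show ?thesis
      proof eventually_elim
        case (elim z)
        then have "G (u t z) < G a" using Gu[of t z] t by simp
        then show ?case using True upos[of t z] t elim by - (rule less_if_G_greater, auto)
      qed
    next
      case False
      show ?thesis using eventually_gt_at_top[of 0]
      proof eventually_elim
        case (elim z)
        with upos[of t z] t False show ?case by simp
      qed
    qed
  next
    have lim: "((\<lambda>z. t + G z) \<longlongrightarrow> t) at_top" using Ginf by (auto intro!: tendsto_eq_intros)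
    fix a assume a: "\<phi> t < a"
    then have "G a < t" "0 < a" using dec[of "\<phi> t" a] \<phi>[OF t] by auto
    from order_tendstoD(1)[OF lim this(1)] eventually_gt_at_top[of 0] show "\<forall>\<^sub>F z in at_top. u t z < a"
    proof eventually_elim
      case (elim z)
      then have "G a < G (u t z)" using Gu[of t z] t by simp
      then show ?case using \<open>0 < a\<close> upos[of t z] t elim by - (rule less_if_G_greater, auto)
    qed
  qed
  have \<phi>0: "filterlim \<phi> (at_right 0) at_top"
  proof (rule tendsto_imp_filterlim_at_right)
    show "\<forall>\<^sub>F t in at_top. 0 < \<phi> t"
      using eventually_gt_at_top[of 0] by eventually_elim (use \<phi> in blast)
    show "(\<phi> \<longlongrightarrow> 0) at_top"
    proof (rule order_tendstoI)
      fix a :: real assume "a < 0"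
      show "\<forall>\<^sub>F t in at_top. a < \<phi> t"
        using eventually_gt_at_top[of 0]
      proof eventually_elim
        case (elim t)
        with \<phi>[of t] \<open>a < 0\<close> show ?case by simp
      qed
    next
      fix a :: real assume a: "0 < a"
      show "\<forall>\<^sub>F t in at_top. \<phi> t < a"
        using eventually_gt_at_top[of "G a"] eventually_gt_at_top[of 0]
      proof eventually_elim
        case (elim t)
        with \<phi>[of t] a show ?case by - (rule less_if_G_greater, auto)
      qed
    qed
  qed
  \<comment> \<open>The transform at \<open>z = 1\<close> suffices: \<open>u s 1\<close> starts at 1
    and stays at most 1, as the maximal inequality demands.\<close>
  have AE_surv: "AE \<omega> in P x. ennreal t < extinction_time X \<omega> \<longleftrightarrow> 0 < X t \<omega>" if "0 < x" "0 \<le> t" for x t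
  proof (rule survives_iff_positive[OF that])
    show "(\<integral>\<omega>. exp (- X s \<omega>) \<partial>P y) = exp (- y * u s 1)" if "0 < y" "0 \<le> s" for y s
      using law[OF that, of 1] by simp
    show "0 \<le> u s 1 \<and> u s 1 \<le> 1" if "0 \<le> s" for s
      using upos[OF that, of 1] u_le[OF that, of 1] by simp
  qed
  have pos_M: "{\<omega> \<in> space (P x). 0 < X t \<omega>} \<in> sets (P x)" if "0 < x" "0 \<le> t" for x t
    using measurable_X[OF that] by measurable
  have surv: "survival P X t = 1 - exp (- \<phi> t)" if t: "0 < t" for t
  proof -
    have "survival P X t = measure (P 1) {\<omega> \<in> space (P 1). 0 < X t \<omega>}"
      unfolding survival_def
    proof (rule measure_completion_AE_eq)
      show "AE \<omega> in P 1. \<omega> \<in> {\<omega> \<in> space (completion (P 1)). ennreal t < extinction_time X \<omega>}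
          \<longleftrightarrow> \<omega> \<in> {\<omega> \<in> space (P 1). 0 < X t \<omega>}"
        using AE_surv[of 1 t] t by auto
    qed (use pos_M[of 1 t] t in auto)
    also have "\<dots> = 1 - exp (- 1 * \<phi> t)"
      by (rule positive_prob(1)[OF _ _ _ u_lim[OF t]]) (use t law in auto)
    finally show ?thesis by simp
  qed
  define F where "F = survival P X"
  have Fpos: "0 < F t" if "0 < t" for t using surv[OF that] \<phi>[OF that] by (simp add: F_def)
  \<comment> \<open>Survival and \<open>\<phi>\<close> are equivalent at infinity, so the
    normalisation by \<open>F\<close> may be traded for \<open>\<phi>\<close>, on which
    \<open>G\<close> is explicit.\<close>
  have F\<phi>: "((\<lambda>t. F t / \<phi> t) \<longlongrightarrow> 1) at_top"
  proof -
    have "filterlim \<phi> (at 0) at_top" using \<phi>0 by (rule filterlim_mono) (auto simp: at_within_le_at)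
    from filterlim_compose[OF one_minus_exp_over_self this] show ?thesis
    proof (rule Lim_transform_eventually)
      show "\<forall>\<^sub>F t in at_top. (1 - exp (- \<phi> t)) / \<phi> t = F t / \<phi> t"
        using eventually_gt_at_top[of 0] by eventually_elim (simp add: surv F_def)
    qed
  qed
  have rv\<phi>: "regularly_varying \<phi> (- 1 / \<alpha>)"
    unfolding regularly_varying_def
  proof (intro conjI allI impI)
    fix z :: real assume z: "0 < z"
    show "((\<lambda>t. \<phi> (z * t) / \<phi> t) \<longlongrightarrow> z powr (- 1 / \<alpha>)) at_top"
    proof (rule ratio_limit_backward[OF dec Gpos \<alpha>(1) rv \<phi>0 _ z])
      show "\<forall>\<^sub>F t in at_top. 0 < \<phi> (z * t)"
        using eventually_gt_at_top[of 0] by eventually_elim (use \<phi> z in simp)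
      \<comment> \<open>The quotient is eventually equal to \<open>z\<close>, because
        \<open>G (\<phi> t) = t\<close>; inverting \<open>G\<close> turns this into regular
        variation of \<open>\<phi>\<close>.\<close>
      show "((\<lambda>t. G (\<phi> (z * t)) / G (\<phi> t)) \<longlongrightarrow> z) at_top"
      proof (rule Lim_transform_eventually[OF tendsto_const])
        show "\<forall>\<^sub>F t in at_top. z = G (\<phi> (z * t)) / G (\<phi> t)"
          using eventually_gt_at_top[of 0] by eventually_elim (use \<phi> z in simp)
      qed
    qed
  qed (use \<phi> in blast)
  have rvF: "regularly_varying F (- 1 / \<alpha>)"
    by (rule regularly_varying_cong_ratio[OF rv\<phi> Fpos F\<phi>])
  have monoF: "F y \<le> F x" if "0 < x" "x \<le> y" for x y
  proof -
    have "\<phi> y \<le> \<phi> x"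
    proof (cases "x = y")
      case False
      then have "\<phi> y < \<phi> x" using that \<phi>[of x] \<phi>[of y] by - (rule less_if_G_greater, auto)
      then show ?thesis by simp
    qed simp
    with that show ?thesis by (simp add: F_def surv)
  qed
  define h where "h \<theta> = 1 - (1 + \<theta> powr (- \<alpha>)) powr (- 1 / \<alpha>)" for \<theta>
  define N where "N x t = distr (uniform_measure (P x) {\<omega> \<in> space (P x). 0 < X t \<omega>}) borel (\<lambda>\<omega>. F t * X t \<omega>)"
    for x t
  define g where "g x t \<theta> = 1 - (1 - exp (- x * u t (\<theta> * F t))) / (1 - exp (- x * \<phi> t))" for x t \<theta>
  have N_law: "laplace_law (N x t) (g x t)" if "0 < x" "0 < t" for x t
    unfolding N_def g_def
    by (rule conditional_laplace_law(1)[OF that(1) _ law u_lim[OF that(2)]]) (use that \<phi> Fpos in auto)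
  have g_lim: "((\<lambda>t. g x t \<theta>) \<longlongrightarrow> h \<theta>) at_top" if x: "0 < x" and \<theta>: "0 < \<theta>" for x \<theta>
  proof -
    let ?w = "\<lambda>t. u t (\<theta> * F t)"
    have "((\<lambda>t. \<theta> * (F t / \<phi> t)) \<longlongrightarrow> \<theta> * 1) at_top" by (intro tendsto_intros F\<phi>)
    then have "((\<lambda>t. (\<theta> * F t) / \<phi> t) \<longlongrightarrow> \<theta>) at_top" by simp
    from ratio_limit_forward[OF dec Gpos rv \<phi>0 \<theta> this]
    have "((\<lambda>t. 1 + G (\<theta> * F t) / G (\<phi> t)) \<longlongrightarrow> 1 + \<theta> powr (- \<alpha>)) at_top"
      by (intro tendsto_intros)
    \<comment> \<open>Dividing \<open>G (u t (\<theta> * F t)) = t + G (\<theta> * F t)\<close> by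
      \<open>t = G (\<phi> t)\<close> produces the summand 1.\<close>
    then have Gw: "((\<lambda>t. G (?w t) / G (\<phi> t)) \<longlongrightarrow> 1 + \<theta> powr (- \<alpha>)) at_top"
    proof (rule Lim_transform_eventually)
      show "\<forall>\<^sub>F t in at_top. 1 + G (\<theta> * F t) / G (\<phi> t) = G (?w t) / G (\<phi> t)"
        using eventually_gt_at_top[of 0]
      proof eventually_elim
        case (elim t)
        then have "G (?w t) = t + G (\<theta> * F t)" using Fpos \<theta> by (intro Gu) auto
        with \<phi>[OF elim] elim show ?case by (simp add: add_divide_distrib)
      qed
    qed
    have wpos: "\<forall>\<^sub>F t in at_top. 0 < ?w t"
      using eventually_gt_at_top[of 0]
    proof eventually_elim
      case (elim t)
      then show ?case using upos[of t "\<theta> * F t"] Fpos[of t] \<theta> by simp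
    qed
    have c0: "0 < 1 + \<theta> powr (- \<alpha>)" by (simp add: add_pos_nonneg)
    have w\<phi>: "((\<lambda>t. ?w t / \<phi> t) \<longlongrightarrow> (1 + \<theta> powr (- \<alpha>)) powr (- 1 / \<alpha>)) at_top"
      by (rule ratio_limit_backward[OF dec Gpos \<alpha>(1) rv \<phi>0 wpos c0 Gw])
    have w0: "filterlim ?w (at_right 0) at_top"
    proof (rule tendsto_imp_filterlim_at_right[OF _ wpos])
      have "(\<phi> \<longlongrightarrow> 0) at_top" using \<phi>0 by (simp add: filterlim_at)
      from tendsto_mult[OF w\<phi> this]
      have "((\<lambda>t. ?w t / \<phi> t * \<phi> t) \<longlongrightarrow> 0) at_top" by simp
      then show "(?w \<longlongrightarrow> 0) at_top"
      proof (rule Lim_transform_eventually)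
        show "\<forall>\<^sub>F t in at_top. ?w t / \<phi> t * \<phi> t = ?w t"
          using eventually_gt_at_top[of 0]
        proof eventually_elim
          case (elim t)
          with \<phi>[OF elim] show ?case by simp
        qed
      qed
    qed
    from tendsto_diff[OF tendsto_const one_minus_exp_ratio[OF w0 \<phi>0 w\<phi> x], of 1]
    show ?thesis by (simp add: g_def h_def)
  qed
  have h0: "(h \<longlongrightarrow> 1) (at_right 0)" unfolding h_def by (rule yaglom_transform_at_0[OF \<alpha>(1)])
  have conv: "\<exists>\<mu>. laplace_law \<mu> h \<and> weak_conv_m (\<lambda>n. N x (max 1 (T n))) \<mu>"
    if x: "0 < x" and T: "filterlim T at_top sequentially" for x T
  proof -
    \<comment> \<open>Times are cut off at 1 so that every member of the sequence is a genuine
      conditional law; for large \<open>n\<close> nothing changes.\<close>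
    have T': "filterlim (\<lambda>n. max 1 (T n)) at_top sequentially"
      by (rule filterlim_at_top_mono[OF T]) simp
    show ?thesis
    proof (rule laplace_continuity)
      show "laplace_law (N x (max 1 (T n))) (g x (max 1 (T n)))" for n using x by (intro N_law) auto
      show "(\<lambda>n. g x (max 1 (T n)) \<theta>) \<longlonglongrightarrow> h \<theta>" if "0 < \<theta>" for \<theta>
        by (rule filterlim_compose[OF g_lim[OF x that] T'])
    qed (use h0 in auto)
  qed
  obtain \<mu> where \<mu>: "laplace_law \<mu> h"
    using conv[OF zero_less_one filterlim_real_sequentially] by blast
  interpret \<mu>: real_distribution \<mu> using \<mu> by (simp add: laplace_law_def)
  have no_atoms: "measure \<mu> {y} = 0" for y
    by (rule yaglom_law_no_atoms[OF _ \<alpha>]) (use \<mu> in \<open>simp add: h_def[abs_def]\<close>)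
  have cdf_conv: "((\<lambda>t. cdf (N x t) y) \<longlongrightarrow> cdf \<mu> y) at_top" if x: "0 < x" for x y
  proof (rule tendsto_at_topI_sequentially)
    fix T :: "nat \<Rightarrow> real" assume T: "filterlim T at_top sequentially"
    \<comment> \<open>Each sequence and each starting point gives its own weak limit; all have the
      transform \<open>h\<close> and hence equal \<open>\<mu>\<close>. Without atoms every
      \<open>y\<close> is a continuity point.\<close>
    obtain \<nu> where "laplace_law \<nu> h" "weak_conv_m (\<lambda>n. N x (max 1 (T n))) \<nu>"
      using conv[OF x T] by blast
    moreover from this have "\<nu> = \<mu>" using laplace_law_unique \<mu> by blast
    moreover have "isCont (cdf \<mu>) y" by (simp add: \<mu>.isCont_cdf no_atoms)
    ultimately have "(\<lambda>n. cdf (N x (max 1 (T n))) y) \<longlonglongrightarrow> cdf \<mu> y"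
      by (simp add: weak_conv_m_def weak_conv_def)
    then show "(\<lambda>n. cdf (N x (T n)) y) \<longlonglongrightarrow> cdf \<mu> y"
    proof (rule Lim_transform_eventually)
      have "\<forall>\<^sub>F n in sequentially. 1 \<le> T n" using T by (simp add: filterlim_at_top)
      then show "\<forall>\<^sub>F n in sequentially. cdf (N x (max 1 (T n))) y = cdf (N x (T n)) y"
        by eventually_elim (simp add: max_def)
    qed
  qed
  have cond: "\<P>(\<omega> in completion (P x). F t * X t \<omega> \<le> y \<bar> ennreal t < extinction_time X \<omega>) = cdf (N x t) y"
    if x: "0 < x" and t: "0 < t" for x t y
  proof -
    have mX[measurable]: "X t \<in> borel_measurable (P x)" using measurable_X[OF x] t by simp
    let ?A = "{\<omega> \<in> space (P x). 0 < X t \<omega>}" and ?B = "{\<omega> \<in> space (P x). F t * X t \<omega> \<le> y}"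
    have AE: "AE \<omega> in P x. ennreal t < extinction_time X \<omega> \<longleftrightarrow> 0 < X t \<omega>"
      using AE_surv[OF x] t by simp
    have "measure (completion (P x)) {\<omega> \<in> space (completion (P x)). ennreal t < extinction_time X \<omega>} = measure (P x) ?A"
      by (rule measure_completion_AE_eq) (use AE in auto)
    moreover have "measure (completion (P x)) {\<omega> \<in> space (completion (P x)).
        F t * X t \<omega> \<le> y \<and> ennreal t < extinction_time X \<omega>} = measure (P x) (?A \<inter> ?B)"
      by (rule measure_completion_AE_eq) (use AE in auto)
    moreover have "cdf (N x t) y = measure (P x) (?A \<inter> ?B) / measure (P x) ?A"
      unfolding N_def
      by (rule conditional_laplace_law(2)[OF x _ law u_lim[OF t]]) (use x t \<phi> Fpos in auto)
    ultimately show ?thesis by (simp add: cond_prob_def)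
  qed
  show ?thesis
  proof (intro conjI allI impI exI[of _ \<mu>])
    show "real_distribution \<mu>" by (rule \<mu>.real_distribution_axioms)
    have AE0: "AE y in \<mu>. 0 \<le> y" using \<mu> by (simp add: laplace_law_def)
    then show "measure \<mu> {0..} = 1" by (subst \<mu>.prob_eq_1) auto
    show "((\<lambda>t. \<P>(\<omega> in completion (P x). survival P X t * X t \<omega> \<le> y \<bar> ennreal t < extinction_time X \<omega>))
        \<longlongrightarrow> cdf \<mu> y) at_top" if "0 < x" for x y
    proof (rule Lim_transform_eventually[OF cdf_conv[OF that]])
      show "\<forall>\<^sub>F t in at_top. cdf (N x t) y
          = \<P>(\<omega> in completion (P x). survival P X t * X t \<omega> \<le> y \<bar> ennreal t < extinction_time X \<omega>)"
        using eventually_gt_at_top[of 0] by eventually_elim (simp add: cond[OF that, folded F_def] F_def[symmetric])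
    qed
    show "(LINT y:{0..}|\<mu>. exp (- \<theta> * y)) = 1 - (1 + \<theta> powr (- \<alpha>)) powr (- 1 / \<alpha>)" if "0 < \<theta>" for \<theta>
    proof -
      have "(LINT y:{0..}|\<mu>. exp (- \<theta> * y)) = (\<integral>y. exp (- \<theta> * y) \<partial>\<mu>)"
        unfolding set_lebesgue_integral_def
      proof (rule integral_cong_AE)
        show "AE y in \<mu>. indicat_real {0..} y *\<^sub>R exp (- \<theta> * y) = exp (- \<theta> * y)"
          using AE0 by eventually_elim simp
      qed auto
      also have "\<dots> = h \<theta>" using \<mu> that unfolding laplace_law_def by blast
      finally show ?thesis by (simp add: h_def)
    qed
    show "regularly_varying (survival P X) (- 1 / \<alpha>)" using rvF by (simp add: F_def)
    show "filterlim (\<lambda>t. t powr (1 / \<alpha> + \<delta>) * survival P X t) at_top at_top" if "0 < \<delta>" for \<delta>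
      using monotone_regularly_varying_powr(2)[OF rvF monoF, of "1 / \<alpha> + \<delta>"] that by (simp add: F_def)
    show "((\<lambda>t. t powr (1 / \<alpha> - \<delta>) * survival P X t) \<longlongrightarrow> 0) at_top" if "0 < \<delta>" for \<delta>
      using monotone_regularly_varying_powr(1)[OF rvF monoF, of "1 / \<alpha> - \<delta>"] that by (simp add: F_def)
  qed
qed

end
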